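(* Let $\Omega\subseteq\mathbb{H}$ be a hinged domain and let $f:\Omega\to\mathbb{H}$ be a slice regular function. For all $\alpha,\beta\in\mathbb{R}$ with $\beta\geq0$ and all $I,J,K\in\mathbb{S}$ with $J\neq K$ such that $\alpha+\beta I,\alpha+\beta J,\alpha+\beta K\in\Omega$, the equality \[f(\alpha+\beta I)=(J-K)^{-1}\left[Jf(\alpha+\beta J)-Kf(\alpha+\beta K)\right]+I(J-K)^{-1}\left[f(\alpha+\beta J)-f(\alpha+\beta K)\right]\] holds. As a consequence, for each $x\in\Omega$, the spherical value function $f_s^\circ:\Omega\to\mathbb{H}$ is constant on $\mathbb{S}_x\cap\Omega$ and, if $x\notin\mathbb{R}$, the spherical derivative $f'_s:\Omega\setminus\mathbb{R}\to\mathbb{H}$ is constant on $\mathbb{S}_x\cap\Omega$.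
   Context: Basic notation. $\mathbb{H}$ is the algebra of quaternions (Euclidean topology), $\mathbb{S}=\{w\in\mathbb{H}: w^2=-1\}$. For $I\in\mathbb{S}$: $\mathbb{C}_I=\mathbb{R}+\mathbb{R}I$, $\mathbb{C}_I^{\geqslant}=\{\alpha+\beta I:\alpha,\beta\in\mathbb{R},\beta\ge0\}$. For $T\subseteq\mathbb{H}$: $T_I=T\cap\mathbb{C}_I$, $T_I^{\geqslant}=T\cap\mathbb{C}_I^{\geqslant}$. For $x=\alpha+\beta I$ ($\alpha,\beta\in\mathbb{R}$, $I\in\mathbb{S}$), $\mathbb{S}_x=\alpha+\beta\mathbb{S}$. A domain is a nonempty connected open subset of $\mathbb{H}$. A function $f:\Omega\to\mathbb{H}$ on a domain is slice regular if for every $I\in\mathbb{S}$ the restriction $f_{|\Omega_I}$ is $C^1$ and $\left(\frac{\partial}{\partial\alpha}+I\frac{\partial}{\partial\beta}\right)f(\alpha+\beta I)=0$ on $\Omega_I$. An open $U\subseteq\mathbb{H}$ is speared if, for all $I\in\mathbb{S}$, each connected component of $U_I^{\geqslant}$ includes a real point. A speared domain is a domain that is a speared open set. A set $T\subseteq\mathbb{H}$ is symmetric if $x\in T$ implies $\mathbb{S}_x\subseteq T$; $\mathrm{core}(U)$ is the largest symmetric speared open subset of the open set $U$. Spherical value and derivative. Let $f$ be slice regular on a speared domain $\Omega$. For each $J_0\in\mathbb{S}$ there is a speared open $\Lambda\subseteq\Omega$ with $\mathrm{core}(\Omega)\cup\Omega_{J_0}^{\geqslant}\subseteq\Lambda$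 such that $f(\alpha+\beta I)=(J-K)^{-1}[Jf(\alpha+\beta J)-Kf(\alpha+\beta K)]+I(J-K)^{-1}[f(\alpha+\beta J)-f(\alpha+\beta K)]$ whenever $J\ne K$, $\beta\ge0$ and $\alpha+\beta I,\alpha+\beta J,\alpha+\beta K\in\Lambda$. For $x_0=\alpha+\beta J_0\in\Omega$ with $\beta\ge0$, set $f_s^\circ(x_0)=(J-K)^{-1}[Jf(\alpha+\beta J)-Kf(\alpha+\beta K)]$ and, if $\beta>0$, $f'_s(x_0)=\beta^{-1}(J-K)^{-1}[f(\alpha+\beta J)-f(\alpha+\beta K)]$, for any $J\neq K$ with $\alpha+\beta J,\alpha+\beta K\in\Lambda$ (independent of choices). Hinged points. Let $\Omega$ be a speared domain. Let $\mathbb{R}_{\mathbb{C}}=\mathbb{R}+\imath\mathbb{R}$ be a copy of the complex plane, with $\phi_J:\mathbb{R}_{\mathbb{C}}\to\mathbb{C}_J$, $\alpha+\imath\beta\mapsto\alpha+\beta J$, and for $J,K\in\mathbb{S}$ set $E^{J,K}=\phi_J^{-1}(\Omega_J^{\geqslant})\cap\phi_K^{-1}(\Omega_K^{\geqslant})$. Let $x_0=\alpha+\beta J_0$, $x_1=\alpha+\beta J_1$, $y_0=\alpha'+\beta'J_0$, $y_1=\alpha'+\beta'J_1$ be points of $\Omega$, with $\beta,\beta'\geq0$, $J_0,J_1\in\mathbb{S}$. We say $(x_1,y_1)$ shadows $(x_0,y_0)$ in $\Omega$ if there is a path $\gamma:[0,1]\to E^{J_0,J_1}$ with $\gamma(0)=\alpha+\beta\imath$,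 $\gamma(1)=\alpha'+\beta'\imath$. We say $x_1$ is strongly hinged to $x_0$ in $\Omega$ if there is $y\in\Omega\cap\mathbb{R}$ such that $(x_1,y)$ shadows $(x_0,y)$. Let $t\ge1$ be an integer, $T=\{0,\dots,t\}$ and $\{x_s\}_{s=0}^t$ a finite sequence in $\Omega$. For $s,s'\in T$ with $|s-s'|=1$, there is a simple step at $s_0=\min\{s,s'\}$ if (1) $x_{s'}$ belongs to the connected component of $\mathbb{S}_{x_s}\cap\Omega$ that includes $x_s$; or (2) $x_{s'}$ is strongly hinged to $x_s$. If (1) and (2) are false but (3) there exist $s'',s'''\in T\setminus\{s,s'\}$ with $s''-s'''=s'-s$ such that $(x_{s''},x_{s'''})$ shadows $(x_s,x_{s'})$, then, with $\underline{s}=\min\{s,s',s'',s'''\}$ and $\overline{s}=\max\{s,s',s'',s'''\}-1$, there is a double step at $(\underline{s},\overline{s})$. The sequence is a chain of length $t$ connecting $x_0$ and $x_t$ if, after erasing from $T$ the index $t$ and all indices where a simple step happens, there remains an even number $2\ell$ of indices, which can be listed as $\underline{s}_1,\overline{s}_1,\ldots,\underline{s}_\ell,\overline{s}_\ell$ so that for all $m,n\in\{1,\dots,\ell\}$: a double step happens at $(\underline{s}_m,\overline{s}_m)$ (whence $\underline{s}_m<\overline{s}_m$); $\underline{s}_1<\ldots<\underline{s}_\ell$; and if $m<n$ then either $\overline{s}_m<\underline{s}_n$ or $\overline{s}_m>\overline{s}_n$. For $x,x'\in\Omega$, $x'$ is hinged to $x$ in $\Omega$, written $x\sim x'$, if there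 is a chain connecting $x$ and $x'$. A speared domain $\Omega$ is a hinged domain if, for each $x\in\Omega$, $x\sim x'$ for all $x'\in\mathbb{S}_x\cap\Omega$. *)

theory Defs
  imports "HOL-Analysis.Analysis"
begin

section \<open>Quaternions\<close>

datatype quat = Quat (qre: real) (qi: real) (qj: real) (qk: real)

lemma quat_eq_iff:
  "p = q \<longleftrightarrow> qre p = qre q \<and> qi p = qi q \<and> qj p = qj q \<and> qk p = qk q"
  by (cases p; cases q) simp

instantiation quat :: real_vector
begin

definition "0 = Quat 0 0 0 0"
definition "p + q = Quat (qre p + qre q) (qi p + qi q) (qj p + qj q) (qk p + qk q)"
definition "- p = Quat (- qre p) (- qi p) (- qj p) (- qk p)"
definition "p - q = Quat (qre p - qre q) (qi p - qi q) (qj p - qj q) (qk p - qk q)"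
definition "r *\<^sub>R p = Quat (r * qre p) (r * qi p) (r * qj p) (r * qk p)"

instance
  by standard
    (simp_all add: quat_eq_iff zero_quat_def plus_quat_def uminus_quat_def minus_quat_def
      scaleR_quat_def algebra_simps)

end

lemma quat_vector_sel [simp]:
  "qre 0 = 0" "qi 0 = 0" "qj 0 = 0" "qk 0 = 0"
  "qre (p + q) = qre p + qre q" "qi (p + q) = qi p + qi q"
  "qj (p + q) = qj p + qj q" "qk (p + q) = qk p + qk q"
  "qre (- p) = - qre p" "qi (- p) = - qi p" "qj (- p) = - qj p" "qk (- p) = - qk p"
  "qre (p - q) = qre p - qre q" "qi (p - q) = qi p - qi q"
  "qj (p - q) = qj p - qj q" "qk (p - q) = qk p - qk q"
  "qre (r *\<^sub>R p) = r * qre p" "qi (r *\<^sub>R p) = r * qi p"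
  "qj (r *\<^sub>R p) = r * qj p" "qk (r *\<^sub>R p) = r * qk p"
  by (simp_all add: zero_quat_def plus_quat_def uminus_quat_def minus_quat_def scaleR_quat_def)

instantiation quat :: real_algebra_1
begin

definition "1 = Quat 1 0 0 0"

definition "p * q = Quat
  (qre p * qre q - qi p * qi q - qj p * qj q - qk p * qk q)
  (qre p * qi q + qi p * qre q + qj p * qk q - qk p * qj q)
  (qre p * qj q - qi p * qk q + qj p * qre q + qk p * qi q)
  (qre p * qk q + qi p * qj q - qj p * qi q + qk p * qre q)"

instance
  by standard (simp_all add: quat_eq_iff one_quat_def times_quat_def algebra_simps)

end

lemma quat_mult_sel [simp]:
  "qre 1 = 1" "qi 1 = 0" "qj 1 = 0" "qk 1 = 0"
  "qre (p * q) = qre p * qre q - qi p * qi q - qj p * qj q - qk p * qk q"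
  "qi (p * q) = qre p * qi q + qi p * qre q + qj p * qk q - qk p * qj q"
  "qj (p * q) = qre p * qj q - qi p * qk q + qj p * qre q + qk p * qi q"
  "qk (p * q) = qre p * qk q + qi p * qj q - qj p * qi q + qk p * qre q"
  by (simp_all add: one_quat_def times_quat_def)

instantiation quat :: real_inner
begin

definition inner_quat :: "quat \<Rightarrow> quat \<Rightarrow> real" where
  "inner_quat p q = qre p * qre q + qi p * qi q + qj p * qj q + qk p * qk q"
definition norm_quat :: "quat \<Rightarrow> real" where "norm_quat p = sqrt (inner p p)"
definition sgn_quat :: "quat \<Rightarrow> quat" where "sgn_quat p = p /\<^sub>R norm p"
definition dist_quat :: "quat \<Rightarrow> quat \<Rightarrow> real" where "dist_quat p q = norm (p - q)"
definition [code del]: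
  "(uniformity :: (quat \<times> quat) filter) = (INF e\<in>{0 <..}. principal {(x, y). dist x y < e})"
definition [code del]:
  "open (U :: quat set) \<longleftrightarrow> (\<forall>x\<in>U. \<forall>\<^sub>F (x', y) in uniformity. x' = x \<longrightarrow> y \<in> U)"

instance
proof
  fix p q r :: quat and a :: real and U :: "quat set"
  show "dist p q = norm (p - q)"
    by (rule dist_quat_def)
  show "sgn p = p /\<^sub>R norm p"
    by (rule sgn_quat_def)
  show "(uniformity :: (quat \<times> quat) filter) = (INF e\<in>{0 <..}. principal {(x, y). dist x y < e})"
    by (rule uniformity_quat_def)
  show "open U \<longleftrightarrow> (\<forall>x\<in>U. \<forall>\<^sub>F (x', y) in uniformity. x' = x \<longrightarrow> y \<in> U)"
    by (rule open_quat_def)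
  show "norm p = sqrt (inner p p)"
    by (rule norm_quat_def)
  show "inner p q = inner q p" "inner (p + q) r = inner p r + inner q r"
    "inner (a *\<^sub>R p) q = a * inner p q"
    by (simp_all add: inner_quat_def algebra_simps)
  show "0 \<le> inner p p"
    by (simp add: inner_quat_def)
  show "inner p p = 0 \<longleftrightarrow> p = 0"
    by (simp add: inner_quat_def quat_eq_iff add_nonneg_eq_0_iff)
qed

end

lemma quat_norm_eq: "norm p = sqrt ((qre p)\<^sup>2 + (qi p)\<^sup>2 + (qj p)\<^sup>2 + (qk p)\<^sup>2)"
  by (simp add: norm_quat_def inner_quat_def power2_eq_square)

lemma four_squares:
  fixes a b c d e f g h :: real
  shows "(a * e - b * f - c * g - d * h)\<^sup>2 + (a * f + b * e + c * h - d * g)\<^sup>2 +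
      (a * g - b * h + c * e + d * f)\<^sup>2 + (a * h + b * g - c * f + d * e)\<^sup>2 =
    (a\<^sup>2 + b\<^sup>2 + c\<^sup>2 + d\<^sup>2) * (e\<^sup>2 + f\<^sup>2 + g\<^sup>2 + h\<^sup>2)"
  by (simp add: power2_eq_square algebra_simps)

instantiation quat :: real_normed_div_algebra
begin

definition inverse_quat :: "quat \<Rightarrow> quat" where
  "inverse_quat p = Quat (qre p) (- qi p) (- qj p) (- qk p) /\<^sub>R (norm p)\<^sup>2"
definition divide_quat :: "quat \<Rightarrow> quat \<Rightarrow> quat" where
  "divide_quat p q = p * inverse q"

instance
proof
  fix p q :: quat
  have n2: "(norm p)\<^sup>2 = (qre p)\<^sup>2 + (qi p)\<^sup>2 + (qj p)\<^sup>2 + (qk p)\<^sup>2" for p :: quat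
    unfolding quat_norm_eq by (rule real_sqrt_pow2) simp
  show "inverse (0 :: quat) = 0"
    by (simp add: inverse_quat_def)
  show "p div q = p * inverse q"
    by (rule divide_quat_def)
  show "norm (p * q) = norm p * norm q"
  proof -
    have "(norm (p * q))\<^sup>2 = (norm p * norm q)\<^sup>2"
      unfolding power_mult_distrib n2 quat_mult_sel by (rule four_squares)
    then show ?thesis
      by (simp add: power2_eq_iff_nonneg)
  qed
  assume "p \<noteq> 0"
  then have n0: "(norm p)\<^sup>2 \<noteq> 0"
    by simp
  let ?c = "Quat (qre p) (- qi p) (- qj p) (- qk p)"
  have "?c * p = (norm p)\<^sup>2 *\<^sub>R 1" "p * ?c = (norm p)\<^sup>2 *\<^sub>R 1"
    unfolding n2 by (simp_all add: quat_eq_iff power2_eq_square algebra_simps)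
  then show "inverse p * p = 1" "p * inverse p = 1"
    using n0 by (simp_all add: inverse_quat_def)
qed

end

instantiation quat :: euclidean_space
begin

definition Basis_quat :: "quat set" where
  "Basis_quat = {Quat 1 0 0 0, Quat 0 1 0 0, Quat 0 0 1 0, Quat 0 0 0 1}"

instance
proof
  fix u v x :: quat
  show "(Basis :: quat set) \<noteq> {}" "finite (Basis :: quat set)"
    by (simp_all add: Basis_quat_def)
  show "inner u v = (if u = v then 1 else 0)" if "u \<in> Basis" "v \<in> Basis"
    using that unfolding Basis_quat_def by (elim insertE emptyE) (simp_all add: inner_quat_def)
  show "(\<forall>u\<in>Basis. inner x u = 0) \<longleftrightarrow> x = 0"
    by (simp add: Basis_quat_def inner_quat_def quat_eq_iff[of x 0])
qed

end


section \<open>Slices and slice regular functions\<close>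

definition imag_units :: "quat set" (\<open>\<S>\<close>) where
  "\<S> = {w. w\<^sup>2 = -1}"

definition slice_pt :: "real \<Rightarrow> real \<Rightarrow> quat \<Rightarrow> quat" where
  "slice_pt \<alpha> \<beta> J = of_real \<alpha> + of_real \<beta> * J"

definition slice_map :: "quat \<Rightarrow> complex \<Rightarrow> quat" where
  "slice_map J z = slice_pt (Re z) (Im z) J"

definition half_plane :: "quat \<Rightarrow> quat set" where
  "half_plane J = {slice_pt \<alpha> \<beta> J | \<alpha> \<beta>. \<beta> \<ge> 0}"

definition half_slice :: "quat set \<Rightarrow> quat \<Rightarrow> quat set" where
  "half_slice T J = T \<inter> half_plane J"

definition quat_sphere :: "quat \<Rightarrow> quat set" where
  "quat_sphere x = {slice_pt \<alpha> \<beta> J | \<alpha> \<beta> J. J \<in> \<S> \<and> (\<exists>I\<in>\<S>. x = slice_pt \<alpha> \<beta> I)}"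

definition quat_domain :: "quat set \<Rightarrow> bool" where
  "quat_domain \<Omega> \<longleftrightarrow> open \<Omega> \<and> connected \<Omega> \<and> \<Omega> \<noteq> {}"

text \<open>The restriction of \<open>f\<close> to a slice is regarded as a function of
  \<open>z = \<alpha> + \<i>\<beta>\<close>, with real Frechet derivative \<open>D z\<close>; thus \<open>D z 1\<close> and
  \<open>D z \<i>\<close> are its partial derivatives in \<open>\<alpha>\<close> and \<open>\<beta>\<close>.\<close>

definition slice_regular_on :: "quat set \<Rightarrow> (quat \<Rightarrow> quat) \<Rightarrow> bool" where
  "slice_regular_on \<Omega> f \<longleftrightarrow>
    (\<forall>I\<in>\<S>. \<exists>D :: complex \<Rightarrow> complex \<Rightarrow>\<^sub>L quat.
       continuous_on (slice_map I -` \<Omega>) D \<and>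
       (\<forall>z\<in>slice_map I -` \<Omega>.
          ((\<lambda>z. f (slice_map I z)) has_derivative blinfun_apply (D z)) (at z) \<and>
          blinfun_apply (D z) 1 + I * blinfun_apply (D z) \<i> = 0))"


section \<open>Speared sets and cores\<close>

definition speared :: "quat set \<Rightarrow> bool" where
  "speared U \<longleftrightarrow> open U \<and> (\<forall>I\<in>\<S>. \<forall>C\<in>components (half_slice U I). C \<inter> \<real> \<noteq> {})"

definition speared_domain :: "quat set \<Rightarrow> bool" where
  "speared_domain \<Omega> \<longleftrightarrow> quat_domain \<Omega> \<and> speared \<Omega>"

definition symmetric :: "quat set \<Rightarrow> bool" where
  "symmetric T \<longleftrightarrow> (\<forall>x\<in>T. quat_sphere x \<subseteq> T)"

definition core :: "quat set \<Rightarrow> quat set" where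
  "core U = \<Union>{V. V \<subseteq> U \<and> symmetric V \<and> speared V}"

lemma speared_Union:
  assumes "\<And>V. V \<in> \<V> \<Longrightarrow> speared V"
  shows "speared (\<Union>\<V>)"
  unfolding speared_def
proof (intro conjI ballI)
  show "open (\<Union>\<V>)"
    using assms by (auto simp: speared_def)
next
  fix I C assume I: "I \<in> \<S>" and C: "C \<in> components (half_slice (\<Union>\<V>) I)"
  then obtain x where x: "x \<in> half_slice (\<Union>\<V>) I"
    and Cx: "C = connected_component_set (half_slice (\<Union>\<V>) I) x"
    by (auto simp: components_def)
  from x obtain V where V: "V \<in> \<V>" "x \<in> half_slice V I"
    by (auto simp: half_slice_def)
  have "connected_component_set (half_slice V I) x \<in> components (half_slice V I)"
    using V by (auto simp: components_def)
  then have "connected_component_set (half_slice V I) x \<inter> \<real> \<noteq> {}"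
    using assms[OF V(1)] I by (auto simp: speared_def)
  moreover have "connected_component_set (half_slice V I) x \<subseteq> C"
    unfolding Cx by (rule connected_component_mono) (use V in \<open>auto simp: half_slice_def\<close>)
  ultimately show "C \<inter> \<real> \<noteq> {}"
    by auto
qed

lemma core_eq_Greatest: "core U = (GREATEST V. V \<subseteq> U \<and> symmetric V \<and> speared V)"
proof -
  have "speared (core U)"
    unfolding core_def by (rule speared_Union) auto
  then show ?thesis
    by (intro Greatest_equality[symmetric]) (auto simp: core_def symmetric_def)
qed


section \<open>Spherical value and spherical derivative\<close>

definition representation_formula ::
    "(quat \<Rightarrow> quat) \<Rightarrow> real \<Rightarrow> real \<Rightarrow> quat \<Rightarrow> quat \<Rightarrow> quat \<Rightarrow> bool" where
  "representation_formula f \<alpha> \<beta> I J K \<longleftrightarrow>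
     f (slice_pt \<alpha> \<beta> I) =
       inverse (J - K) * (J * f (slice_pt \<alpha> \<beta> J) - K * f (slice_pt \<alpha> \<beta> K)) +
       I * inverse (J - K) * (f (slice_pt \<alpha> \<beta> J) - f (slice_pt \<alpha> \<beta> K))"

definition representation_set ::
    "quat set \<Rightarrow> (quat \<Rightarrow> quat) \<Rightarrow> quat \<Rightarrow> quat set \<Rightarrow> bool" where
  "representation_set \<Omega> f J\<^sub>0 \<Lambda> \<longleftrightarrow>
     speared \<Lambda> \<and> \<Lambda> \<subseteq> \<Omega> \<and> core \<Omega> \<union> half_slice \<Omega> J\<^sub>0 \<subseteq> \<Lambda> \<and>
     (\<forall>\<alpha> \<beta>. \<forall>I\<in>\<S>. \<forall>J\<in>\<S>. \<forall>K\<in>\<S>. J \<noteq> K \<and> \<beta> \<ge> 0 \<and>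
        slice_pt \<alpha> \<beta> I \<in> \<Lambda> \<and> slice_pt \<alpha> \<beta> J \<in> \<Lambda> \<and> slice_pt \<alpha> \<beta> K \<in> \<Lambda> \<longrightarrow>
        representation_formula f \<alpha> \<beta> I J K)"

text \<open>For a slice regular function on a speared domain, the values described below exist and do
  not depend on the choice of \<open>\<Lambda>\<close>, \<open>J\<close> and \<open>K\<close> (nor of \<open>J\<^sub>0\<close> when \<open>x\<^sub>0\<close> is real).\<close>

definition spherical_value :: "quat set \<Rightarrow> (quat \<Rightarrow> quat) \<Rightarrow> quat \<Rightarrow> quat" where
  "spherical_value \<Omega> f x\<^sub>0 = (THE v. \<exists>\<alpha> \<beta>. \<exists>J\<^sub>0\<in>\<S>. \<exists>\<Lambda>. \<exists>J\<in>\<S>. \<exists>K\<in>\<S>.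
     \<beta> \<ge> 0 \<and> x\<^sub>0 = slice_pt \<alpha> \<beta> J\<^sub>0 \<and> representation_set \<Omega> f J\<^sub>0 \<Lambda> \<and>
     J \<noteq> K \<and> slice_pt \<alpha> \<beta> J \<in> \<Lambda> \<and> slice_pt \<alpha> \<beta> K \<in> \<Lambda> \<and>
     v = inverse (J - K) * (J * f (slice_pt \<alpha> \<beta> J) - K * f (slice_pt \<alpha> \<beta> K)))"

definition spherical_derivative :: "quat set \<Rightarrow> (quat \<Rightarrow> quat) \<Rightarrow> quat \<Rightarrow> quat" where
  "spherical_derivative \<Omega> f x\<^sub>0 = (THE v. \<exists>\<alpha> \<beta>. \<exists>J\<^sub>0\<in>\<S>. \<exists>\<Lambda>. \<exists>J\<in>\<S>. \<exists>K\<in>\<S>.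
     \<beta> > 0 \<and> x\<^sub>0 = slice_pt \<alpha> \<beta> J\<^sub>0 \<and> representation_set \<Omega> f J\<^sub>0 \<Lambda> \<and>
     J \<noteq> K \<and> slice_pt \<alpha> \<beta> J \<in> \<Lambda> \<and> slice_pt \<alpha> \<beta> K \<in> \<Lambda> \<and>
     v = of_real (inverse \<beta>) * inverse (J - K) * (f (slice_pt \<alpha> \<beta> J) - f (slice_pt \<alpha> \<beta> K)))"


section \<open>Hinged domains\<close>

definition shadow_region :: "quat set \<Rightarrow> quat \<Rightarrow> quat \<Rightarrow> complex set" where
  "shadow_region \<Omega> J K = slice_map J -` half_slice \<Omega> J \<inter> slice_map K -` half_slice \<Omega> K"

text \<open>\<open>shadows \<Omega> (x\<^sub>1, y\<^sub>1) (x\<^sub>0, y\<^sub>0)\<close> means that \<open>(x\<^sub>1, y\<^sub>1)\<close> shadows \<open>(x\<^sub>0, y\<^sub>0)\<close> in \<open>\<Omega>\<close>.\<close>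

definition shadows :: "quat set \<Rightarrow> quat \<times> quat \<Rightarrow> quat \<times> quat \<Rightarrow> bool" where
  "shadows \<Omega> = (\<lambda>(x\<^sub>1, y\<^sub>1) (x\<^sub>0, y\<^sub>0).
     {x\<^sub>0, x\<^sub>1, y\<^sub>0, y\<^sub>1} \<subseteq> \<Omega> \<and>
     (\<exists>\<alpha> \<beta> \<alpha>' \<beta>'. \<exists>J\<^sub>0\<in>\<S>. \<exists>J\<^sub>1\<in>\<S>. \<beta> \<ge> 0 \<and> \<beta>' \<ge> 0 \<and>
        x\<^sub>0 = slice_pt \<alpha> \<beta> J\<^sub>0 \<and> x\<^sub>1 = slice_pt \<alpha> \<beta> J\<^sub>1 \<and>
        y\<^sub>0 = slice_pt \<alpha>' \<beta>' J\<^sub>0 \<and> y\<^sub>1 = slice_pt \<alpha>' \<beta>' J\<^sub>1 \<and>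
        (\<exists>\<gamma>. path \<gamma> \<and> path_image \<gamma> \<subseteq> shadow_region \<Omega> J\<^sub>0 J\<^sub>1 \<and>
             pathstart \<gamma> = Complex \<alpha> \<beta> \<and> pathfinish \<gamma> = Complex \<alpha>' \<beta>')))"

text \<open>\<open>strongly_hinged \<Omega> x\<^sub>1 x\<^sub>0\<close> means that \<open>x\<^sub>1\<close> is strongly hinged to \<open>x\<^sub>0\<close> in \<open>\<Omega>\<close>.\<close>

definition strongly_hinged :: "quat set \<Rightarrow> quat \<Rightarrow> quat \<Rightarrow> bool" where
  "strongly_hinged \<Omega> x\<^sub>1 x\<^sub>0 \<longleftrightarrow> (\<exists>y\<in>\<Omega> \<inter> \<real>. shadows \<Omega> (x\<^sub>1, y) (x\<^sub>0, y))"

definition simply_linked :: "quat set \<Rightarrow> quat \<Rightarrow> quat \<Rightarrow> bool" where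
  "simply_linked \<Omega> x x' \<longleftrightarrow>
     x' \<in> connected_component_set (quat_sphere x \<inter> \<Omega>) x \<or> strongly_hinged \<Omega> x' x"

text \<open>A finite sequence \<open>x\<^sub>0, \<dots>, x\<^sub>t\<close> is represented by \<open>t\<close> and a function on \<open>nat\<close> whose values
  beyond \<open>t\<close> are irrelevant.\<close>

definition simple_step :: "quat set \<Rightarrow> nat \<Rightarrow> (nat \<Rightarrow> quat) \<Rightarrow> nat \<Rightarrow> bool" where
  "simple_step \<Omega> t x s\<^sub>0 \<longleftrightarrow>
     (\<exists>s\<in>{0..t}. \<exists>s'\<in>{0..t}. \<bar>int s - int s'\<bar> = 1 \<and> s\<^sub>0 = min s s' \<and>
        simply_linked \<Omega> (x s) (x s'))"

definition double_step :: "quat set \<Rightarrow> nat \<Rightarrow> (nat \<Rightarrow> quat) \<Rightarrow> nat \<Rightarrow> nat \<Rightarrow> bool" where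
  "double_step \<Omega> t x a b \<longleftrightarrow>
     (\<exists>s\<in>{0..t}. \<exists>s'\<in>{0..t}. \<bar>int s - int s'\<bar> = 1 \<and> \<not> simply_linked \<Omega> (x s) (x s') \<and>
        (\<exists>s''\<in>{0..t} - {s, s'}. \<exists>s'''\<in>{0..t} - {s, s'}.
           int s'' - int s''' = int s' - int s \<and>
           shadows \<Omega> (x s'', x s''') (x s, x s') \<and>
           a = Min {s, s', s'', s'''} \<and> b = Max {s, s', s'', s'''} - 1))"

definition is_chain :: "quat set \<Rightarrow> nat \<Rightarrow> (nat \<Rightarrow> quat) \<Rightarrow> bool" where
  "is_chain \<Omega> t x \<longleftrightarrow>
     t \<ge> 1 \<and> x ` {0..t} \<subseteq> \<Omega> \<and>
     (\<exists>l a b. let R = {0..t} - {t} - {s. simple_step \<Omega> t x s} in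
        card R = 2 * l \<and> R = a ` {1..l} \<union> b ` {1..l} \<and>
        (\<forall>m\<in>{1..l}. double_step \<Omega> t x (a m) (b m)) \<and>
        strict_mono_on {1..l} a \<and>
        (\<forall>m\<in>{1..l}. \<forall>n\<in>{1..l}. m < n \<longrightarrow> b m < a n \<or> b m > b n))"

definition hinged :: "quat set \<Rightarrow> quat \<Rightarrow> quat \<Rightarrow> bool" where
  "hinged \<Omega> x x' \<longleftrightarrow> (\<exists>t \<xi>. is_chain \<Omega> t \<xi> \<and> \<xi> 0 = x \<and> \<xi> t = x')"

definition hinged_domain :: "quat set \<Rightarrow> bool" where
  "hinged_domain \<Omega> \<longleftrightarrow>
     speared_domain \<Omega> \<and> (\<forall>x\<in>\<Omega>. \<forall>x'\<in>quat_sphere x \<inter> \<Omega>. hinged \<Omega> x x')"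

end

(* Near each point of a half slice, f(alpha + beta I) = A(z) + I B(z) for all I close to the given
   imaginary unit, where (A, B) is a holomorphic stem function of z = alpha + i beta. This holds near
   a real point for all I at once, and it propagates along half slices by the identity theorem.
   Call two points of a sphere linked if their stem functions have the same germ. Linking is an
   equivalence relation; it holds locally on spheres, and the identity theorem transports it along
   the path of a shadow, in both directions. A simple step thus links its two points, and a double
   step links its outer pair of points once the inner pair is linked, so that a chain links its
   end points by induction on the noncrossing pairing of its steps. In a hinged domain all points of
   a sphere therefore share one stem function, which gives the representation formula on all of
   Omega; hence Omega itself serves as the set Lambda defining spherical value and derivative. *)

theory Submission
  imports Defs "HOL-Complex_Analysis.Conformal_Mappings"
begin

subsection \<open>Imaginary units and slices\<close>

lemma imag_unitsD:
  assumes "J \<in> \<S>"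
  shows "J * J = -1" "qre J = 0" "norm J = 1" "J \<noteq> 0"
proof -
  show JJ: "J * J = -1"
    using assms by (simp add: imag_units_def power2_eq_square)
  have eqs: "qre J * qre J - qi J * qi J - qj J * qj J - qk J * qk J = -1"
    "qre J * qi J = 0" "qre J * qj J = 0" "qre J * qk J = 0"
    using JJ by (auto simp: quat_eq_iff)
  show re: "qre J = 0"
  proof (rule ccontr)
    assume "qre J \<noteq> 0"
    with eqs have "qre J * qre J = -1" by auto
    then show False using zero_le_square[of "qre J"] by linarith
  qed
  show "norm J = 1"
    using eqs re by (simp add: quat_norm_eq power2_eq_square)
  then show "J \<noteq> 0" by auto
qed

lemma imag_units_mult_left_cancel: "J \<in> \<S> \<Longrightarrow> J * (J * q) = - q"
  by (metis imag_unitsD(1) mult.assoc mult_minus1)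

lemma imag_units_uminus: "J \<in> \<S> \<Longrightarrow> - J \<in> \<S>"
  by (simp add: imag_units_def)

lemma imag_units_neq_uminus: "J \<in> \<S> \<Longrightarrow> J \<noteq> - J"
  using imag_unitsD(4)[of J] by (auto simp: quat_eq_iff)

text \<open>Conjugating \<open>J\<close> by \<open>1 + t q\<close>, with \<open>q\<close> not
  commuting with \<open>J\<close>, gives imaginary units that differ from \<open>J\<close> and tend
  to it as t tends to 0. This supplies the second unit needed to pin down the coefficients of
  \<open>A + I * B\<close> from values near one unit.\<close>

lemma imag_unit_perturb:
  assumes "J \<in> \<S>" "\<epsilon> > 0"
  obtains K where "K \<in> \<S>" "K \<noteq> J" "dist J K < \<epsilon>"
proof -
  obtain q :: quat where q: "q * J \<noteq> J * q"
  proof -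
    have "\<exists>q. q * J \<noteq> J * q"
    proof (rule ccontr)
      assume "\<not> ?thesis"
      then have "Quat 0 1 0 0 * J = J * Quat 0 1 0 0" "Quat 0 0 1 0 * J = J * Quat 0 0 1 0"
        by blast+
      then have "qi J = 0 \<and> qj J = 0 \<and> qk J = 0" by (auto simp: quat_eq_iff)
      with imag_unitsD(2,4)[OF assms(1)] show False by (simp add: quat_eq_iff)
    qed
    with that show thesis by blast
  qed
  define u where "u t = 1 + t *\<^sub>R q" for t :: real
  have u: "(u \<longlongrightarrow> 1) (at 0)"
    unfolding u_def by (rule tendsto_eq_intros refl | simp)+
  have lim: "((\<lambda>t. u t * J * inverse (u t)) \<longlongrightarrow> J) (at 0)"
    using tendsto_mult[OF tendsto_mult[OF u tendsto_const] tendsto_inverse[OF u], of J] by simp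
  have "\<forall>\<^sub>F t in at 0. dist (u t * J * inverse (u t)) J < \<epsilon> \<and> u t \<noteq> 0 \<and> t \<noteq> 0"
    using tendstoD[OF lim assms(2)] tendsto_imp_eventually_ne[OF u, of 0]
    by (simp add: eventually_conj_iff eventually_neq_at_within)
  then obtain t where t: "dist (u t * J * inverse (u t)) J < \<epsilon>" "u t \<noteq> 0" "t \<noteq> 0"
    using eventually_happens[of _ "at (0::real)"] by auto
  define K where "K = u t * J * inverse (u t)"
  have "K * K = u t * (J * (inverse (u t) * u t) * J) * inverse (u t)"
    unfolding K_def by (simp only: mult.assoc)
  then have "K * K = -1"
    using t(2) imag_unitsD(1)[OF assms(1)] by simp
  then have "K \<in> \<S>" by (simp add: imag_units_def power2_eq_square)
  moreover have "K \<noteq> J"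
  proof
    assume "K = J"
    then have "u t * J = J * u t"
      unfolding K_def using t(2) by (metis mult.assoc left_inverse mult_1_right)
    then show False using q t(3) by (simp add: u_def algebra_simps)
  qed
  ultimately show thesis using t(1) that by (simp add: K_def dist_commute)
qed

text \<open>Left multiplication by \<open>J\<close> is skew-adjoint because \<open>J\<close> is
  purely imaginary.\<close>

lemma inner_imag_unit_mult:
  assumes "J \<in> \<S>"
  shows "inner v (J * q) = - inner (J * v) q"
  using imag_unitsD(2)[OF assms] by (simp add: inner_quat_def algebra_simps)

section \<open>Complex coordinates on slices\<close>

lemma slice_map_altdef: "slice_map J z = of_real (Re z) + of_real (Im z) * J"
  by (simp add: slice_map_def slice_pt_def)

lemma slice_pt_eq_slice_map: "slice_pt \<alpha> \<beta> J = slice_map J (Complex \<alpha> \<beta>)"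
  by (simp add: slice_map_def)

lemma of_real_quat_sel [simp]:
  "qre (of_real r) = r" "qi (of_real r) = 0" "qj (of_real r) = 0" "qk (of_real r) = 0"
  by (simp_all add: of_real_def)

lemma continuous_slice_map:
  "continuous_on UNIV (\<lambda>p. slice_map (fst p) (snd p))"
  unfolding slice_map_altdef by (intro continuous_intros)

lemma slice_map_real: "Im z = 0 \<Longrightarrow> slice_map J z = of_real (Re z)"
  by (simp add: slice_map_altdef)

text \<open>As \<open>J\<close> is a unit vector orthogonal to 1, a ball about a real point pulls
  back to the same disc in every slice. Hence one disc serves all units at once.\<close>

lemma dist_slice_map_real:
  assumes "J \<in> \<S>" "Im y = 0"
  shows "dist (of_real (Re y)) (slice_map J w) = dist y w"
proof -
  have "(norm J)\<^sup>2 = 1" using imag_unitsD(3)[OF assms(1)] by simp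
  then have "(qi J)\<^sup>2 + (qj J)\<^sup>2 + (qk J)\<^sup>2 = 1"
    unfolding quat_norm_eq using imag_unitsD(2)[OF assms(1)] by simp
  then have "(Im w * qi J)\<^sup>2 + (Im w * qj J)\<^sup>2 + (Im w * qk J)\<^sup>2 = (Im w)\<^sup>2"
    by (simp add: power_mult_distrib flip: distrib_left)
  then show ?thesis
    using imag_unitsD(2)[OF assms(1)] assms(2)
    by (simp add: dist_norm quat_norm_eq cmod_def slice_map_altdef add.assoc)
qed

lemma slice_map_eqD:
  assumes eq: "slice_map J z = slice_map K w" and "J \<in> \<S>" "K \<in> \<S>" "Im z \<ge> 0" "Im w \<ge> 0"
  shows "z = w" "Im z > 0 \<Longrightarrow> J = K"
proof -
  have re: "Re z = Re w"
    using arg_cong[OF eq, of qre] imag_unitsD(2)[OF assms(2)] imag_unitsD(2)[OF assms(3)]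
    by (simp add: slice_map_altdef)
  with eq have im: "of_real (Im z) * J = of_real (Im w) * K"
    by (simp add: slice_map_altdef)
  from arg_cong[OF im, of norm] have "Im z = Im w"
    using imag_unitsD(3) assms by (simp add: norm_mult)
  then show "z = w" using re by (simp add: complex_eq_iff)
  then show "J = K" if "Im z > 0" using that im by simp
qed

subsection \<open>Continuation of the stem functions\<close>

text \<open>The Cauchy-Riemann equation for maps into the quaternions, seen as a complex vector
  space through left multiplication by \<open>I\<close>.\<close>

definition left_holomorphic :: "quat \<Rightarrow> (complex \<Rightarrow> quat) \<Rightarrow> complex set \<Rightarrow> bool" where
  "left_holomorphic I g W \<longleftrightarrow>
     (\<forall>z\<in>W. \<exists>D. (g has_derivative D) (at z) \<and> D 1 + I * D \<i> = 0)"

text \<open>The map \<open>q \<mapsto> \<langle>v, q\<rangle> + \<i>\<langle>Iv, q\<rangle>\<close> turns left multiplication by \<open>I\<close> into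
  multiplication by \<open>\<i>\<close>, which reduces the claim to the complex identity theorem.\<close>

lemma left_holomorphic_continuation:
  assumes g: "left_holomorphic I g W" and I: "I \<in> \<S>"
    and W: "open W" "connected W" and U: "U \<subseteq> W" "\<xi> \<in> W" "\<xi> islimpt U"
    and g0: "\<And>z. z \<in> U \<Longrightarrow> g z = 0" and w: "w \<in> W"
  shows "g w = 0"
proof -
  \<comment> \<open>Testing against the very value \<open>g w\<close> makes one functional enough:
    \<open>L v = 0\<close> will give \<open>inner v v = 0\<close>.\<close>
  define v where "v = g w"
  define L where "L q = Complex (inner v q) (inner (I * v) q)" for q
  have blin: "bounded_linear L"
  proof -
    have "bounded_linear (\<lambda>q. complex_of_real (inner v q) + \<i> * complex_of_real (inner (I * v) q))"
      by (intro bounded_linear_add bounded_linear_compose[OF bounded_linear_mult_right]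
          bounded_linear_compose[OF bounded_linear_of_real] bounded_linear_inner_right)
    then show ?thesis by (simp add: L_def[abs_def] Complex_eq)
  qed
  have "(\<lambda>z. L (g z)) holomorphic_on W"
  proof (rule holomorphic_onI)
    fix z assume "z \<in> W"
    then obtain D where D: "(g has_derivative D) (at z)" "D 1 + I * D \<i> = 0"
      using g unfolding left_holomorphic_def by blast
    have lin: "linear D" using D(1) has_derivative_linear by blast
    have Di: "D \<i> = I * D 1"
      using D(2) imag_units_mult_left_cancel[OF I, of "D \<i>"]
      by (metis add_eq_0_iff minus_minus mult_minus_right)
    \<comment> \<open>Real linearity and the Cauchy-Riemann equation express \<open>D\<close>
      through \<open>D 1\<close>; skew-adjointness then turns \<open>I\<close> into the complex unit
      under \<open>L\<close>.\<close>
    have "L (D h) = L (D 1) * h" for h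
    proof -
      have "D h = D (Re h *\<^sub>R 1 + Im h *\<^sub>R \<i>)"
        by (rule arg_cong[of _ _ D]) (simp add: complex_eq_iff)
      also have "\<dots> = Re h *\<^sub>R D 1 + Im h *\<^sub>R (I * D 1)"
        by (simp only: linear_add[OF lin] linear_scale[OF lin] Di)
      finally have "D h = Re h *\<^sub>R D 1 + Im h *\<^sub>R (I * D 1)" .
      then show ?thesis
        by (simp add: L_def complex_eq_iff inner_add_right inner_imag_unit_mult[OF I]
            imag_units_mult_left_cancel[OF I])
    qed
    then have "(\<lambda>h. L (D h)) = (*) (L (D 1))" by (rule ext)
    then have "((\<lambda>z. L (g z)) has_derivative (*) (L (D 1))) (at z)"
      using bounded_linear.has_derivative[OF blin D(1)] by (simp only:)
    then show "(\<lambda>z. L (g z)) field_differentiable (at z within W)"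
      by (metis field_differentiable_at_within field_differentiable_def has_field_derivative_def)
  qed
  from analytic_continuation[OF this W U _ w] g0 have "L v = 0"
    by (simp add: v_def L_def complex_eq_iff)
  then have "inner v v = 0" by (simp add: L_def complex_eq_iff)
  then show ?thesis by (simp add: v_def)
qed

text \<open>\<open>stem_a f J K\<close> and \<open>stem_b f J K\<close> are the components of the stem function: the spherical
  value, and \<open>\<beta>\<close> times the spherical derivative.\<close>

definition stem_b :: "(quat \<Rightarrow> quat) \<Rightarrow> quat \<Rightarrow> quat \<Rightarrow> complex \<Rightarrow> quat" where
  "stem_b f J K z = inverse (J - K) * (f (slice_map J z) - f (slice_map K z))"

definition stem_a :: "(quat \<Rightarrow> quat) \<Rightarrow> quat \<Rightarrow> quat \<Rightarrow> complex \<Rightarrow> quat" where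
  "stem_a f J K z = f (slice_map J z) - J * stem_b f J K z"

text \<open>Subtracting the two equations leaves \<open>(J - K) * (B - B') = 0\<close> in a division
  ring. All comparisons of stem functions rest on this.\<close>

lemma affine_unique:
  fixes A B A' B' :: quat
  assumes "A + J * B = A' + J * B'" "A + K * B = A' + K * B'" "J \<noteq> K"
  shows "A = A'" "B = B'"
proof -
  have "(J - K) * (B - B') = (A + J * B) - (A + K * B) - ((A' + J * B') - (A' + K * B'))"
    by (simp add: algebra_simps)
  then have "(J - K) * (B - B') = 0" using assms by simp
  then show "B = B'" using assms(3) by simp
  then show "A = A'" using assms(1) by simp
qed

lemma stem_ab:
  assumes "J \<noteq> K"
  shows "f (slice_map J z) = stem_a f J K z + J * stem_b f J K z"
    "f (slice_map K z) = stem_a f J K z + K * stem_b f J K z"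
proof -
  have "(J - K) * stem_b f J K z = f (slice_map J z) - f (slice_map K z)"
    using assms by (simp add: stem_b_def flip: mult.assoc)
  then show "f (slice_map J z) = stem_a f J K z + J * stem_b f J K z"
    "f (slice_map K z) = stem_a f J K z + K * stem_b f J K z"
    by (simp_all add: stem_a_def algebra_simps)
qed

lemma stem_ab_unique:
  assumes "f (slice_map J z) = A + J * B" "f (slice_map K z) = A + K * B" "J \<noteq> K"
  shows "stem_a f J K z = A" "stem_b f J K z = B"
  using affine_unique[OF _ _ assms(3), of "stem_a f J K z" "stem_b f J K z" A B]
    stem_ab[OF assms(3), of f z] assms by auto

text \<open>The components built from \<open>J\<close> and \<open>K\<close> satisfy the
  Cauchy-Riemann system. The defect of the formula at any third unit \<open>I\<close> is therefore
  holomorphic with respect to \<open>I\<close>, and its zeros propagate over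
  \<open>W\<close>.\<close>

lemma stem_continuation:
  assumes f: "slice_regular_on \<Omega> f" and units: "I \<in> \<S>" "J \<in> \<S>" "K \<in> \<S>" "J \<noteq> K"
    and W: "open W" "connected W" and U: "U \<subseteq> W" "\<xi> \<in> W" "\<xi> islimpt U"
    and sub: "\<And>z. z \<in> W \<Longrightarrow> slice_map I z \<in> \<Omega> \<and> slice_map J z \<in> \<Omega> \<and> slice_map K z \<in> \<Omega>"
    and eq: "\<And>z. z \<in> U \<Longrightarrow> f (slice_map I z) = stem_a f J K z + I * stem_b f J K z"
    and w: "w \<in> W"
  shows "f (slice_map I w) = stem_a f J K w + I * stem_b f J K w"
proof -
  let ?g = "\<lambda>z. f (slice_map I z) - (stem_a f J K z + I * stem_b f J K z)"
  have "left_holomorphic I ?g W"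
    unfolding left_holomorphic_def
  proof
    fix z assume z: "z \<in> W"
    have "\<exists>D. ((\<lambda>z. f (slice_map L z)) has_derivative D) (at z) \<and> D 1 + L * D \<i> = 0"
      if "L \<in> \<S>" "slice_map L z \<in> \<Omega>" for L
      using f that unfolding slice_regular_on_def by blast
    with units sub[OF z] obtain DI DJ DK where
      DI: "((\<lambda>z. f (slice_map I z)) has_derivative DI) (at z)" "DI 1 + I * DI \<i> = 0" and
      DJ: "((\<lambda>z. f (slice_map J z)) has_derivative DJ) (at z)" "DJ 1 + J * DJ \<i> = 0" and
      DK: "((\<lambda>z. f (slice_map K z)) has_derivative DK) (at z)" "DK 1 + K * DK \<i> = 0"
      by metis
    define DB where "DB h = inverse (J - K) * (DJ h - DK h)" for h
    define DA where "DA h = DJ h - J * DB h" for h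
    have JK: "(J - K) * DB h = DJ h - DK h" for h
      using units(4) by (simp add: DB_def flip: mult.assoc)
    have DJ': "DJ h = DA h + J * DB h" and DK': "DK h = DA h + K * DB h" for h
      using JK[of h] by (simp_all add: DA_def algebra_simps)
    \<comment> \<open>The Cauchy-Riemann operator for \<open>L\<close>, applied to
      \<open>A + L * B\<close>, is affine in \<open>L\<close> with coefficients free of
      \<open>L\<close>. Vanishing for \<open>J\<close> and for \<open>K\<close>, it has both
      coefficients zero.\<close>
    have "(DA 1 - DB \<i>) + L * (DB 1 + DA \<i>) = (DA 1 + L * DB 1) + L * (DA \<i> + L * DB \<i>)"
      if "L \<in> \<S>" for L
      using imag_units_mult_left_cancel[OF that] by (simp add: algebra_simps)
    from this[OF units(2)] this[OF units(3)] DJ(2) DK(2) have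
      "(DA 1 - DB \<i>) + J * (DB 1 + DA \<i>) = 0 + J * 0" "(DA 1 - DB \<i>) + K * (DB 1 + DA \<i>) = 0 + K * 0"
      by (simp_all only: DJ' DK' mult_zero_right add_0_right)
    from affine_unique[OF this units(4)] have CR: "DA 1 = DB \<i>" "DB 1 = - DA \<i>"
      by (simp_all add: add_eq_0_iff2)
    have "(?g has_derivative (\<lambda>h. DI h - (DA h + I * DB h))) (at z)"
      unfolding stem_a_def stem_b_def DA_def DB_def
      by (intro derivative_intros DI(1) DJ(1) DK(1))
    moreover have "(DI 1 - (DA 1 + I * DB 1)) + I * (DI \<i> - (DA \<i> + I * DB \<i>)) = 0"
      using DI(2) imag_units_mult_left_cancel[OF units(1)] by (simp add: CR algebra_simps)
    ultimately show "\<exists>D. (?g has_derivative D) (at z) \<and> D 1 + I * D \<i> = 0"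
      by blast
  qed
  from left_holomorphic_continuation[OF this units(1) W U _ w] eq show ?thesis by simp
qed

text \<open>The stem functions of \<open>f\<close> near \<open>(z, J)\<close> and near \<open>(z, K)\<close> exist and have the same germ
  at \<open>z\<close>. Comparing germs, rather than values at \<open>z\<close>, is what allows continuation along paths.\<close>

definition stem_linked :: "(quat \<Rightarrow> quat) \<Rightarrow> quat \<Rightarrow> quat \<Rightarrow> complex \<Rightarrow> bool" where
  "stem_linked f J K z \<longleftrightarrow> (\<exists>A B. \<exists>\<epsilon>>0. \<forall>w\<in>ball z \<epsilon>. \<forall>I\<in>\<S> \<inter> (ball J \<epsilon> \<union> ball K \<epsilon>).
     f (slice_map I w) = A w + I * B w)"

lemma stem_linked_sym: "stem_linked f J K z \<Longrightarrow> stem_linked f K J z"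
  unfolding stem_linked_def by (simp add: Un_commute)

text \<open>Both pairs of stem functions represent \<open>f\<close> for every unit near
  \<open>K\<close>. Evaluating at \<open>K\<close> and at a perturbed unit \<open>K'\<close> shows
  that they agree near \<open>z\<close>.\<close>

lemma stem_linked_trans:
  assumes "stem_linked f J K z" "stem_linked f K L z" "K \<in> \<S>"
  shows "stem_linked f J L z"
proof -
  obtain A B \<epsilon> where 1: "\<epsilon> > 0" "\<And>w I. w \<in> ball z \<epsilon> \<Longrightarrow> I \<in> \<S> \<Longrightarrow> I \<in> ball J \<epsilon> \<union> ball K \<epsilon> \<Longrightarrow>
      f (slice_map I w) = A w + I * B w"
    using assms(1) unfolding stem_linked_def by blast
  obtain A' B' \<epsilon>' where 2: "\<epsilon>' > 0" "\<And>w I. w \<in> ball z \<epsilon>' \<Longrightarrow> I \<in> \<S> \<Longrightarrow> I \<in> ball K \<epsilon>' \<union> ball L \<epsilon>' \<Longrightarrow>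
      f (slice_map I w) = A' w + I * B' w"
    using assms(2) unfolding stem_linked_def by blast
  define \<delta> where "\<delta> = min \<epsilon> \<epsilon>'"
  have \<delta>: "\<delta> > 0" "\<delta> \<le> \<epsilon>" "\<delta> \<le> \<epsilon>'" using 1(1) 2(1) by (auto simp: \<delta>_def)
  obtain K' where K': "K' \<in> \<S>" "K' \<noteq> K" "dist K K' < \<delta>"
    using imag_unit_perturb[OF assms(3) \<delta>(1)] by blast
  have AB: "A w = A' w" "B w = B' w" if "w \<in> ball z \<delta>" for w
  proof -
    have "A w + K * B w = A' w + K * B' w" "A w + K' * B w = A' w + K' * B' w"
      using 1(2)[of w K] 2(2)[of w K] 1(2)[of w K'] 2(2)[of w K'] that \<delta> K' assms(3) 1(1) 2(1) by auto
    from affine_unique[OF this] K'(2) show "A w = A' w" "B w = B' w" by auto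
  qed
  have "f (slice_map I w) = A w + I * B w"
    if "w \<in> ball z \<delta>" "I \<in> \<S> \<inter> (ball J \<delta> \<union> ball L \<delta>)" for w I
  proof (cases "I \<in> ball J \<delta>")
    case True
    then show ?thesis using 1(2)[of w I] that \<delta> by auto
  next
    case False
    then show ?thesis using 2(2)[of w I] AB[OF that(1)] that \<delta> by auto
  qed
  then show ?thesis
    unfolding stem_linked_def using \<delta>(1) by blast
qed

text \<open>The comparison behind transitivity, carried out at \<open>z\<close> alone, with the
  common coefficients kept.\<close>

lemma stem_linked_eval:
  assumes "stem_linked f I J z" "stem_linked f J K z" "I \<in> \<S>" "J \<in> \<S>" "K \<in> \<S>"
  obtains a b where "f (slice_map I z) = a + I * b" "f (slice_map J z) = a + J * b"
    "f (slice_map K z) = a + K * b"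
proof -
  obtain A B \<epsilon> where 1: "\<epsilon> > 0" "\<And>w L. w \<in> ball z \<epsilon> \<Longrightarrow> L \<in> \<S> \<Longrightarrow> L \<in> ball I \<epsilon> \<union> ball J \<epsilon> \<Longrightarrow>
      f (slice_map L w) = A w + L * B w"
    using assms(1) unfolding stem_linked_def by blast
  obtain A' B' \<epsilon>' where 2: "\<epsilon>' > 0" "\<And>w L. w \<in> ball z \<epsilon>' \<Longrightarrow> L \<in> \<S> \<Longrightarrow> L \<in> ball J \<epsilon>' \<union> ball K \<epsilon>' \<Longrightarrow>
      f (slice_map L w) = A' w + L * B' w"
    using assms(2) unfolding stem_linked_def by blast
  obtain J' where J': "J' \<in> \<S>" "J' \<noteq> J" "dist J J' < min \<epsilon> \<epsilon>'"
    using imag_unit_perturb[OF assms(4), of "min \<epsilon> \<epsilon>'"] 1(1) 2(1) by auto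
  have "A z + J * B z = A' z + J * B' z" "A z + J' * B z = A' z + J' * B' z"
    using 1(2)[of z J] 2(2)[of z J] 1(2)[of z J'] 2(2)[of z J'] J' assms(4) 1(1) 2(1) by auto
  from affine_unique[OF this] J'(2) have AB: "A z = A' z" "B z = B' z" by auto
  show thesis
    by (rule that[of "A z" "B z"])
      (use 1(2)[of z I] 1(2)[of z J] 2(2)[of z K] AB assms(3-5) 1(1) 2(1) in auto)
qed

section \<open>Continuation of linked germs over an open set\<close>

context
  fixes \<Omega> :: "quat set" and f :: "quat \<Rightarrow> quat"
  assumes opn: "open \<Omega>" and reg: "slice_regular_on \<Omega> f"
begin

text \<open>On the real axis all units give the same point, so the formula holds there with
  \<open>stem_b\<close> equal to 0. The real diameter of a disc about \<open>y\<close> accumulates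
  at \<open>y\<close>, and continuation yields the formula on the whole disc for all units.\<close>

lemma stem_linked_real:
  assumes "J \<in> \<S>" "K \<in> \<S>" "Im y = 0" "slice_map J y \<in> \<Omega>"
  shows "stem_linked f J K y"
proof -
  have "of_real (Re y) \<in> \<Omega>" using assms by (simp add: slice_map_real)
  then obtain r where r: "r > 0" "ball (of_real (Re y)) r \<subseteq> \<Omega>"
    using opn open_contains_ball by blast
  have sub: "slice_map I w \<in> \<Omega>" if "I \<in> \<S>" "w \<in> ball y r" for I w
    using r(2) that dist_slice_map_real[OF that(1) assms(3), of w] by auto
  let ?U = "{w \<in> ball y r. Im w = 0}"
  have lim: "y islimpt ?U"
    unfolding islimpt_approachable
  proof (intro allI impI)
    fix e :: real assume "e > 0"
    let ?w = "y + of_real (min e r / 2)"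
    have "cmod (of_real (min e r / 2)) = min e r / 2"
      using \<open>e > 0\<close> r(1) by (simp only: norm_of_real)
    then have "dist ?w y = min e r / 2"
      by (simp add: dist_norm)
    then show "\<exists>w\<in>?U. w \<noteq> y \<and> dist w y < e"
      using \<open>e > 0\<close> r(1) assms(3) by (intro bexI[of _ ?w]) (auto simp: dist_commute)
  qed
  \<comment> \<open>Any unit other than \<open>J\<close> could serve as the second one;
    \<open>-J\<close> is always available.\<close>
  have "f (slice_map I w) = stem_a f J (-J) w + I * stem_b f J (-J) w"
    if I: "I \<in> \<S>" and w: "w \<in> ball y r" for I w
  proof (rule stem_continuation[OF reg I assms(1) imag_units_uminus[OF assms(1)]
        imag_units_neq_uminus[OF assms(1)] open_ball connected_ball _ _ lim _ _ w])
    show "f (slice_map I z) = stem_a f J (-J) z + I * stem_b f J (-J) z" if "z \<in> ?U" for z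
      using that by (simp add: stem_a_def stem_b_def slice_map_real)
  qed (use r sub I assms(1) imag_units_uminus in auto)
  then show ?thesis
    unfolding stem_linked_def using r(1) by blast
qed

text \<open>The radius is chosen so that units near \<open>J\<close> or \<open>K\<close> keep the
  whole disc inside \<open>\<Omega>\<close>. A link at one point gives the formula near that point,
  and continuation spreads it over the disc.\<close>

lemma stem_linked_locally_constant:
  assumes "J \<in> \<S>" "K \<in> \<S>" "slice_map J z \<in> \<Omega>" "slice_map K z \<in> \<Omega>"
  obtains \<delta> where "\<delta> > 0"
    "\<And>w w'. w \<in> ball z \<delta> \<Longrightarrow> w' \<in> ball z \<delta> \<Longrightarrow> stem_linked f J K w \<Longrightarrow> stem_linked f J K w'"
proof -
  have nbhd: "\<exists>\<delta>>0. \<forall>I w. dist L I < \<delta> \<longrightarrow> dist z w < \<delta> \<longrightarrow> slice_map I w \<in> \<Omega>"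
    if L: "slice_map L z \<in> \<Omega>" for L
  proof -
    have "open ((\<lambda>p. slice_map (fst p) (snd p)) -` \<Omega>)"
      using continuous_slice_map opn by (simp add: continuous_on_open_vimage)
    moreover have "(L, z) \<in> (\<lambda>p. slice_map (fst p) (snd p)) -` \<Omega>"
      using L by simp
    ultimately obtain S T where ST: "open S" "open T" "(L, z) \<in> S \<times> T"
        "S \<times> T \<subseteq> (\<lambda>p. slice_map (fst p) (snd p)) -` \<Omega>"
      by (rule open_prod_elim)
    from ST(3) have "L \<in> S" "z \<in> T" by auto
    from openE[OF ST(1) this(1)] openE[OF ST(2) this(2)] obtain d e where
      "d > 0" "e > 0" "ball L d \<subseteq> S" "ball z e \<subseteq> T" by metis
    with ST(4) show ?thesis
      by (intro exI[of _ "min d e"]) (auto simp: subset_iff)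
  qed
  from nbhd[OF assms(3)] nbhd[OF assms(4)] obtain d e where de: "d > 0" "e > 0"
      "\<forall>I w. dist J I < d \<longrightarrow> dist z w < d \<longrightarrow> slice_map I w \<in> \<Omega>"
      "\<forall>I w. dist K I < e \<longrightarrow> dist z w < e \<longrightarrow> slice_map I w \<in> \<Omega>"
    by auto
  define \<delta> where "\<delta> = min d e"
  have \<delta>: "\<delta> > 0" "\<And>I w. I \<in> ball J \<delta> \<union> ball K \<delta> \<Longrightarrow> w \<in> ball z \<delta> \<Longrightarrow> slice_map I w \<in> \<Omega>"
    using de by (auto simp: \<delta>_def)
  show thesis
  proof (rule that[OF \<delta>(1)])
    fix w w' assume w: "w \<in> ball z \<delta>" "w' \<in> ball z \<delta>" "stem_linked f J K w"
    obtain A B \<epsilon> where AB: "\<epsilon> > 0" "\<And>w' I. w' \<in> ball w \<epsilon> \<Longrightarrow> I \<in> \<S> \<Longrightarrow> I \<in> ball J \<epsilon> \<union> ball K \<epsilon> \<Longrightarrow>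
        f (slice_map I w') = A w' + I * B w'"
      using w(3) unfolding stem_linked_def by blast
    \<comment> \<open>Units within \<open>\<delta>\<close> stay in \<open>\<Omega>\<close>; units
      within \<open>\<epsilon>\<close> satisfy the given formula near \<open>w\<close>. Both are
      required.\<close>
    define \<eta> where "\<eta> = min \<delta> \<epsilon>"
    have \<eta>: "\<eta> > 0" "\<eta> \<le> \<delta>" "\<eta> \<le> \<epsilon>" using \<delta>(1) AB(1) by (auto simp: \<eta>_def)
    obtain J' where J': "J' \<in> \<S>" "J' \<noteq> J" "dist J J' < \<eta>"
      using imag_unit_perturb[OF assms(1) \<eta>(1)] by blast
    define U where "U = ball w \<epsilon> \<inter> ball z \<delta>"
    have lim: "w islimpt U"
      by (rule interior_limit_point) (use w AB(1) in \<open>auto simp: U_def interior_open open_Int\<close>)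
    have *: "f (slice_map I u) = stem_a f J J' u + I * stem_b f J J' u"
      if I: "I \<in> \<S>" "I \<in> ball J \<eta> \<union> ball K \<eta>" and u: "u \<in> ball z \<delta>" for I u
    proof (rule stem_continuation[OF reg I(1) assms(1) J'(1) J'(2)[symmetric] open_ball
          connected_ball _ w(1) lim _ _ u])
      show "U \<subseteq> ball z \<delta>" by (simp add: U_def)
      show "slice_map I v \<in> \<Omega> \<and> slice_map J v \<in> \<Omega> \<and> slice_map J' v \<in> \<Omega>" if "v \<in> ball z \<delta>" for v
        using \<delta>(2)[OF _ that] I(2) J'(3) \<eta> \<delta>(1) by auto
      fix v assume v: "v \<in> U"
      have "f (slice_map J v) = A v + J * B v" "f (slice_map J' v) = A v + J' * B v"
        using AB(2)[of v] v J' assms(1) AB(1) \<eta> by (auto simp: U_def)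
      note AB_eq = stem_ab_unique[OF this J'(2)[symmetric]]
      then show "f (slice_map I v) = stem_a f J J' v + I * stem_b f J J' v"
        using AB(2)[of v I] v I \<eta> AB_eq by (auto simp: U_def)
    qed
    obtain \<rho> where \<rho>: "\<rho> > 0" "ball w' \<rho> \<subseteq> ball z \<delta>"
      using w(2) open_contains_ball open_ball by blast
    show "stem_linked f J K w'"
      unfolding stem_linked_def
    proof (intro exI conjI ballI)
      show "min \<rho> \<eta> > 0" using \<rho>(1) \<eta>(1) by simp
      fix v I assume "v \<in> ball w' (min \<rho> \<eta>)" "I \<in> \<S> \<inter> (ball J (min \<rho> \<eta>) \<union> ball K (min \<rho> \<eta>))"
      then show "f (slice_map I v) = stem_a f J J' v + I * stem_b f J J' v"
        using \<rho> by (intro *) auto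
    qed
  qed
qed

lemma stem_linked_connected:
  assumes "J \<in> \<S>" "K \<in> \<S>" "connected C" "\<And>z. z \<in> C \<Longrightarrow> slice_map J z \<in> \<Omega> \<and> slice_map K z \<in> \<Omega>"
    and "w \<in> C" "w' \<in> C" "stem_linked f J K w"
  shows "stem_linked f J K w'"
proof (rule connected_induction_simple[where P = "stem_linked f J K", OF assms(3,5-7)])
  fix z assume z: "z \<in> C"
  with assms(4) have "slice_map J z \<in> \<Omega>" "slice_map K z \<in> \<Omega>" by auto
  then obtain \<delta> where \<delta>: "\<delta> > 0"
    "\<And>w w'. w \<in> ball z \<delta> \<Longrightarrow> w' \<in> ball z \<delta> \<Longrightarrow> stem_linked f J K w \<Longrightarrow> stem_linked f J K w'"
    by (rule stem_linked_locally_constant[OF assms(1,2)]) (rule that)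
  have "openin (top_of_set C) (C \<inter> ball z \<delta>)" by (simp add: openin_open_Int)
  moreover have "z \<in> C \<inter> ball z \<delta>" using z \<delta>(1) by simp
  moreover have "\<forall>x\<in>C \<inter> ball z \<delta>. \<forall>y\<in>C \<inter> ball z \<delta>. stem_linked f J K x \<longrightarrow> stem_linked f J K y"
    using \<delta>(2) by blast
  ultimately show "\<exists>T. openin (top_of_set C) T \<and> z \<in> T \<and>
      (\<forall>x\<in>T. \<forall>y\<in>T. stem_linked f J K x \<longrightarrow> stem_linked f J K y)"
    by blast
qed

end

subsection \<open>Linked points and chains\<close>

text \<open>With \<open>Im z \<ge> 0\<close> the data \<open>z\<close>, \<open>J\<close>,
  \<open>K\<close> are determined off the real axis; at a real point the units are arbitrary, whence
  the existential form.\<close>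

definition sphere_linked :: "(quat \<Rightarrow> quat) \<Rightarrow> quat \<Rightarrow> quat \<Rightarrow> bool" where
  "sphere_linked f x x' \<longleftrightarrow> (\<exists>z J K. Im z \<ge> 0 \<and> J \<in> \<S> \<and> K \<in> \<S> \<and>
     x = slice_map J z \<and> x' = slice_map K z \<and> stem_linked f J K z)"

lemma sphere_linkedI:
  "stem_linked f J K z \<Longrightarrow> J \<in> \<S> \<Longrightarrow> K \<in> \<S> \<Longrightarrow> Im z \<ge> 0 \<Longrightarrow>
    sphere_linked f (slice_map J z) (slice_map K z)"
  unfolding sphere_linked_def by blast

lemma sphere_linked_sym: "sphere_linked f x x' \<Longrightarrow> sphere_linked f x' x"
  unfolding sphere_linked_def using stem_linked_sym by blast

lemma slice_map_minus: "slice_map (- J) z = slice_map J (cnj z)"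
  by (simp add: slice_map_altdef)

text \<open>The set \<open>quat_sphere\<close> also admits presentations with negative imaginary
  coordinate; conjugating \<open>z\<close> and negating the units normalizes them.\<close>

lemma slice_map_upper_half:
  assumes "I \<in> \<S>" "J \<in> \<S>"
  obtains w I' J' where "Im w \<ge> 0" "I' \<in> \<S>" "J' \<in> \<S>" "slice_map I z = slice_map I' w"
    "slice_map J z = slice_map J' w"
proof (cases "Im z \<ge> 0")
  case True
  then show ?thesis using that assms by blast
next
  case False
  show ?thesis
    by (rule that[of "cnj z" "- I" "- J"])
      (use False assms imag_units_uminus in \<open>auto simp: slice_map_minus\<close>)
qed

lemma quat_slice_cases:
  obtains J z where "J \<in> \<S>" "Im z \<ge> 0" "x = slice_map J z"
proof -
  define r where "r = sqrt ((qi x)\<^sup>2 + (qj x)\<^sup>2 + (qk x)\<^sup>2)"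
  show ?thesis
  proof (cases "r = 0")
    case True
    then have "qi x = 0" "qj x = 0" "qk x = 0"
      by (auto simp: r_def add_nonneg_eq_0_iff)
    moreover have "Quat 0 1 0 0 \<in> \<S>"
      by (simp add: imag_units_def power2_eq_square quat_eq_iff)
    ultimately show ?thesis
      by (intro that[of "Quat 0 1 0 0" "of_real (qre x)"]) (auto simp: slice_map_altdef quat_eq_iff)
  next
    case False
    define J where "J = Quat 0 (qi x / r) (qj x / r) (qk x / r)"
    have sq: "(qi x)\<^sup>2 + (qj x)\<^sup>2 + (qk x)\<^sup>2 = r\<^sup>2" by (simp add: r_def)
    have "(qi x / r)\<^sup>2 + (qj x / r)\<^sup>2 + (qk x / r)\<^sup>2 = 1"
      using False by (simp add: power_divide sq flip: add_divide_distrib)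
    then have "J * J = -1"
      by (simp add: J_def quat_eq_iff power2_eq_square)
    then have "J \<in> \<S>" by (simp add: imag_units_def power2_eq_square)
    moreover have "r \<ge> 0" by (simp add: r_def)
    ultimately show ?thesis
      using False by (intro that[of J "Complex (qre x) r"]) (auto simp: slice_map_altdef quat_eq_iff J_def)
  qed
qed

lemma quat_sphere_slice_map:
  assumes x: "x \<in> quat_sphere (slice_map J z)" and "J \<in> \<S>" "Im z \<ge> 0"
  obtains K where "K \<in> \<S>" "x = slice_map K z"
proof -
  obtain \<alpha> \<beta> I K where "x = slice_map K (Complex \<alpha> \<beta>)" "slice_map J z = slice_map I (Complex \<alpha> \<beta>)"
      "I \<in> \<S>" "K \<in> \<S>"
    using x by (auto simp: quat_sphere_def slice_pt_eq_slice_map)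
  moreover obtain w I' K' where "Im w \<ge> 0" "I' \<in> \<S>" "K' \<in> \<S>"
      "slice_map I (Complex \<alpha> \<beta>) = slice_map I' w" "slice_map K (Complex \<alpha> \<beta>) = slice_map K' w"
    using slice_map_upper_half[of I K] calculation by metis
  ultimately show thesis
    using that slice_map_eqD(1)[of J z I' w] assms by metis
qed

lemma slice_map_in_quat_sphere:
  "J \<in> \<S> \<Longrightarrow> K \<in> \<S> \<Longrightarrow> slice_map K z \<in> quat_sphere (slice_map J z)"
  unfolding quat_sphere_def slice_map_def by blast

lemma stem_linked_nearby:
  assumes "stem_linked f J J z"
  obtains \<epsilon> where "\<epsilon> > 0" "\<And>K. dist J K < \<epsilon> \<Longrightarrow> stem_linked f J K z"
proof -
  obtain A B \<epsilon> where AB: "\<epsilon> > 0" "\<And>w I. w \<in> ball z \<epsilon> \<Longrightarrow> I \<in> \<S> \<Longrightarrow> I \<in> ball J \<epsilon> \<Longrightarrow>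
      f (slice_map I w) = A w + I * B w"
    using assms unfolding stem_linked_def by blast
  show thesis
  proof (rule that[OF AB(1)])
    fix K assume K: "dist J K < \<epsilon>"
    show "stem_linked f J K z"
      unfolding stem_linked_def
    proof (intro exI conjI ballI)
      \<comment> \<open>By the triangle inequality, this radius keeps the ball about
        \<open>K\<close> inside \<open>ball J \<epsilon>\<close>.\<close>
      show "\<epsilon> - dist J K > 0" using K by simp
      fix w I assume w: "w \<in> ball z (\<epsilon> - dist J K)"
        and I: "I \<in> \<S> \<inter> (ball J (\<epsilon> - dist J K) \<union> ball K (\<epsilon> - dist J K))"
      show "f (slice_map I w) = A w + I * B w"
      proof (rule AB(2))
        show "w \<in> ball z \<epsilon>" using w zero_le_dist[of J K] unfolding mem_ball by linarith
        show "I \<in> ball J \<epsilon>" using I zero_le_dist[of J K] dist_triangle[of J I K] unfolding Int_iff Un_iff mem_ball by linarith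
      qed (use I in auto)
    qed
  qed
qed

lemma dist_slice_map_units:
  "dist (slice_map J z) (slice_map K z) = \<bar>Im z\<bar> * dist J K"
proof -
  have "slice_map J z - slice_map K z = of_real (Im z) * (J - K)"
    by (simp add: slice_map_altdef algebra_simps)
  then show ?thesis by (simp add: dist_norm norm_mult)
qed

section \<open>Linking on a speared set\<close>

context
  fixes \<Omega> :: "quat set" and f :: "quat \<Rightarrow> quat"
  assumes spr: "speared \<Omega>" and reg: "slice_regular_on \<Omega> f"
begin

lemma opn: "open \<Omega>"
  using spr by (simp add: speared_def)

text \<open>Spearedness puts a real point in the component of the half slice containing the given
  point. The germ exists at that real point and is carried along the component.\<close>

lemma stem_linked_refl:
  assumes unit: "J \<in> \<S>" and z: "Im z \<ge> 0" "slice_map J z \<in> \<Omega>"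
  shows "stem_linked f J J z"
proof -
  let ?C = "connected_component_set (half_slice \<Omega> J) (slice_map J z)"
  have x: "slice_map J z \<in> half_slice \<Omega> J"
    using z by (auto simp: half_slice_def half_plane_def slice_map_def)
  then have "?C \<in> components (half_slice \<Omega> J)"
    by (auto simp: components_def)
  then obtain y where y: "y \<in> ?C" "y \<in> \<real>"
    using spr unit unfolding speared_def by blast
  \<comment> \<open>Since 1 and \<open>J\<close> are orthonormal, \<open>g\<close> is a continuous
    left inverse of \<open>slice_map J\<close> and moves the component into the complex
    plane.\<close>
  define g where "g q = complex_of_real (inner 1 q) + \<i> * complex_of_real (inner J q)" for q
  have J: "inner 1 (1 :: quat) = 1" "inner J J = 1" "inner J 1 = 0" "inner 1 J = 0"
    using imag_unitsD(2,3)[OF unit] by (simp_all add: norm_eq_1) (simp_all add: inner_quat_def)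
  have inv [simp]: "g (slice_map J w) = w" for w
    using J by (simp add: g_def slice_map_altdef complex_eq_iff inner_add_right of_real_def)
  have "continuous_on ?C g"
    unfolding g_def by (intro continuous_intros)
  then have conn: "connected (g ` ?C)"
    by (intro connected_continuous_image connected_connected_component)
  have sub: "slice_map J w \<in> \<Omega>" if "w \<in> g ` ?C" for w
  proof -
    from that obtain q where q: "w = g q" "q \<in> half_slice \<Omega> J"
      using connected_component_subset by blast
    then obtain w' where "q = slice_map J w'"
      by (auto simp: half_slice_def half_plane_def slice_pt_eq_slice_map)
    with q show ?thesis by (auto simp: half_slice_def)
  qed
  show ?thesis
  proof (rule stem_linked_connected[OF opn reg unit unit conn _ imageI[OF y(1)]])
    show "z \<in> g ` ?C" using x by (intro image_eqI[of _ _ "slice_map J z"]) auto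
    have "Im (g y) = 0"
      using y(2) J(3) by (auto simp: g_def of_real_def elim!: Reals_cases)
    then show "stem_linked f J J (g y)"
      using stem_linked_real[OF opn reg unit unit] sub y(1) by blast
  qed (use sub in auto)
qed

lemma sphere_linked_refl: "x \<in> \<Omega> \<Longrightarrow> sphere_linked f x x"
  unfolding sphere_linked_def using quat_slice_cases[of x] stem_linked_refl by metis

text \<open>Off the real axis the presentation is unique; at a real point any two units are linked,
  so the choice of presentation is harmless.\<close>

lemma sphere_linkedD:
  assumes "sphere_linked f (slice_map J z) (slice_map K z)" "J \<in> \<S>" "K \<in> \<S>" "Im z \<ge> 0"
    and "slice_map J z \<in> \<Omega>"
  shows "stem_linked f J K z"
proof (cases "Im z = 0")
  case True
  then show ?thesis using stem_linked_real[OF opn reg] assms by blast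
next
  case False
  obtain w J' K' where "Im w \<ge> 0" "J' \<in> \<S>" "K' \<in> \<S>" "slice_map J z = slice_map J' w"
      "slice_map K z = slice_map K' w" "stem_linked f J' K' w"
    using assms(1) unfolding sphere_linked_def by blast
  moreover from this have "w = z" using slice_map_eqD(1)[of J z J' w] assms by simp
  ultimately show ?thesis
    using slice_map_eqD(2)[of J z J' w] slice_map_eqD(2)[of K z K' w] assms False by simp
qed

lemma sphere_linked_trans:
  assumes "sphere_linked f x x'" "sphere_linked f x' x''" "x' \<in> \<Omega>"
  shows "sphere_linked f x x''"
proof -
  obtain z J K where 1: "Im z \<ge> 0" "J \<in> \<S>" "K \<in> \<S>" "x = slice_map J z" "x' = slice_map K z"
      "stem_linked f J K z"
    using assms(1) unfolding sphere_linked_def by blast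
  obtain w K' L where 2: "Im w \<ge> 0" "K' \<in> \<S>" "L \<in> \<S>" "x' = slice_map K' w" "x'' = slice_map L w"
    using assms(2) unfolding sphere_linked_def by blast
  have "w = z" using slice_map_eqD(1)[of K' w K z] 1 2 by simp
  then have "stem_linked f K L z"
    using sphere_linkedD[of K z L] assms 1 2 by simp
  from stem_linked_trans[OF 1(6) this 1(3)] show ?thesis
    unfolding sphere_linked_def using 1 2 \<open>w = z\<close> by blast
qed

text \<open>Along the path both slices stay in \<open>\<Omega>\<close>, so a link at either end
  travels to the other.\<close>

lemma shadows_sphere_linked_iff:
  assumes "shadows \<Omega> (x\<^sub>1, y\<^sub>1) (x\<^sub>0, y\<^sub>0)"
  shows "sphere_linked f x\<^sub>0 x\<^sub>1 \<longleftrightarrow> sphere_linked f y\<^sub>0 y\<^sub>1"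
proof -
  obtain \<alpha> \<beta> \<alpha>' \<beta>' J\<^sub>0 J\<^sub>1 \<gamma> where J: "J\<^sub>0 \<in> \<S>" "J\<^sub>1 \<in> \<S>" "\<beta> \<ge> 0" "\<beta>' \<ge> 0"
    and x: "x\<^sub>0 = slice_map J\<^sub>0 (Complex \<alpha> \<beta>)" "x\<^sub>1 = slice_map J\<^sub>1 (Complex \<alpha> \<beta>)"
    and y: "y\<^sub>0 = slice_map J\<^sub>0 (Complex \<alpha>' \<beta>')" "y\<^sub>1 = slice_map J\<^sub>1 (Complex \<alpha>' \<beta>')"
    and \<gamma>: "path \<gamma>" "path_image \<gamma> \<subseteq> shadow_region \<Omega> J\<^sub>0 J\<^sub>1"
      "pathstart \<gamma> = Complex \<alpha> \<beta>" "pathfinish \<gamma> = Complex \<alpha>' \<beta>'"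
    using assms unfolding shadows_def slice_pt_eq_slice_map by auto
  have \<Omega>: "x\<^sub>0 \<in> \<Omega>" "y\<^sub>0 \<in> \<Omega>" using assms by (auto simp: shadows_def)
  have sub: "slice_map J\<^sub>0 w \<in> \<Omega> \<and> slice_map J\<^sub>1 w \<in> \<Omega>" if "w \<in> path_image \<gamma>" for w
    using \<gamma>(2) that by (auto simp: shadow_region_def half_slice_def)
  have ends: "Complex \<alpha> \<beta> \<in> path_image \<gamma>" "Complex \<alpha>' \<beta>' \<in> path_image \<gamma>"
    using pathstart_in_path_image[of \<gamma>] pathfinish_in_path_image[of \<gamma>] \<gamma>(3,4) by auto
  note cont = stem_linked_connected[OF opn reg J(1,2) connected_path_image[OF \<gamma>(1)] sub]
  have "stem_linked f J\<^sub>0 J\<^sub>1 (Complex \<alpha> \<beta>) \<longleftrightarrow> stem_linked f J\<^sub>0 J\<^sub>1 (Complex \<alpha>' \<beta>')"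
    using cont[OF _ ends] cont[OF _ ends(2,1)] by blast
  moreover have "sphere_linked f x\<^sub>0 x\<^sub>1 \<longleftrightarrow> stem_linked f J\<^sub>0 J\<^sub>1 (Complex \<alpha> \<beta>)"
  proof
    assume "sphere_linked f x\<^sub>0 x\<^sub>1"
    then show "stem_linked f J\<^sub>0 J\<^sub>1 (Complex \<alpha> \<beta>)" using sphere_linkedD J \<Omega> x by simp
  next
    assume "stem_linked f J\<^sub>0 J\<^sub>1 (Complex \<alpha> \<beta>)"
    then show "sphere_linked f x\<^sub>0 x\<^sub>1" using sphere_linkedI J x by simp
  qed
  moreover have "sphere_linked f y\<^sub>0 y\<^sub>1 \<longleftrightarrow> stem_linked f J\<^sub>0 J\<^sub>1 (Complex \<alpha>' \<beta>')"
  proof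
    assume "sphere_linked f y\<^sub>0 y\<^sub>1"
    then show "stem_linked f J\<^sub>0 J\<^sub>1 (Complex \<alpha>' \<beta>')" using sphere_linkedD J \<Omega> y by simp
  next
    assume "stem_linked f J\<^sub>0 J\<^sub>1 (Complex \<alpha>' \<beta>')"
    then show "sphere_linked f y\<^sub>0 y\<^sub>1" using sphere_linkedI J y by simp
  qed
  ultimately show ?thesis by blast
qed

text \<open>Within a connected subset of the sphere, linking is an equivalence relation with open
  classes.\<close>

lemma connected_component_sphere_linked:
  assumes "x' \<in> connected_component_set (quat_sphere x \<inter> \<Omega>) x"
  shows "sphere_linked f x x'"
proof -
  obtain T where T: "connected T" "T \<subseteq> quat_sphere x \<inter> \<Omega>" "x \<in> T" "x' \<in> T"
    using assms by (auto simp: connected_component_def)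
  obtain I z where I: "I \<in> \<S>" "Im z \<ge> 0" "x = slice_map I z"
    by (rule quat_slice_cases)
  show ?thesis
  proof (rule connected_equivalence_relation[of T x x' "sphere_linked f", OF T(1,3,4)])
    fix a assume a: "a \<in> T"
    then obtain J where J: "J \<in> \<S>" "a = slice_map J z"
      using quat_sphere_slice_map[of a I z] T(2) I by blast
    have "a \<in> \<Omega>" using a T(2) by blast
    then obtain \<epsilon> where \<epsilon>: "\<epsilon> > 0" "\<And>K. dist J K < \<epsilon> \<Longrightarrow> stem_linked f J K z"
      using stem_linked_nearby[OF stem_linked_refl[OF J(1) I(2)]] J(2) by blast
    \<comment> \<open>Distances on the sphere are \<open>Im z\<close> times distances of units. If
      \<open>Im z = 0\<close> the sphere is a single point and any positive radius will do.\<close>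
    define r where "r = (if Im z = 0 then 1 else Im z * \<epsilon>)"
    have "r > 0" using \<epsilon>(1) I(2) by (simp add: r_def)
    have "sphere_linked f a c" if c: "c \<in> T \<inter> ball a r" for c
    proof -
      obtain K where K: "K \<in> \<S>" "c = slice_map K z"
        using quat_sphere_slice_map[of c I z] T(2) I c by blast
      show ?thesis
      proof (cases "Im z = 0")
        case True
        then have "c = a" using J K by (simp add: slice_map_real)
        then show ?thesis using sphere_linked_refl \<open>a \<in> \<Omega>\<close> by simp
      next
        case False
        then have "dist J K < \<epsilon>"
          using c J K I(2) by (simp add: dist_slice_map_units r_def)
        from \<epsilon>(2)[OF this] show ?thesis
          using sphere_linkedI J K I(2) by simp
      qed
    qed
    then show "\<exists>U. openin (top_of_set T) U \<and> a \<in> U \<and> (\<forall>c\<in>U. sphere_linked f a c)"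
      using a \<open>r > 0\<close> by (intro exI[of _ "T \<inter> ball a r"]) (auto simp: openin_open_Int)
  qed (rule sphere_linked_sym, assumption, rule sphere_linked_trans, assumption+, use T(2) in auto)
qed

text \<open>In the strongly hinged case the shadow path ends at a real point, which is linked to
  itself.\<close>

lemma simply_linked_sphere_linked:
  assumes "simply_linked \<Omega> x x'"
  shows "sphere_linked f x x'"
  using assms unfolding simply_linked_def strongly_hinged_def
proof (elim disjE bexE)
  fix y assume "y \<in> \<Omega> \<inter> \<real>" "shadows \<Omega> (x', y) (x, y)"
  then show ?thesis using shadows_sphere_linked_iff sphere_linked_refl by blast
qed (rule connected_component_sphere_linked)

lemma simple_step_sphere_linked:
  assumes "simple_step \<Omega> t \<xi> i"
  shows "sphere_linked f (\<xi> i) (\<xi> (Suc i))"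
proof -
  obtain s s' where s: "\<bar>int s - int s'\<bar> = 1" "i = min s s'" "simply_linked \<Omega> (\<xi> s) (\<xi> s')"
    using assms by (auto simp: simple_step_def)
  then have "s = i \<and> s' = Suc i \<or> s' = i \<and> s = Suc i"
    by (auto simp: min_def)
  with simply_linked_sphere_linked[OF s(3)] show ?thesis
    using sphere_linked_sym by blast
qed

lemma double_step_sphere_linked:
  assumes "double_step \<Omega> t \<xi> a b"
  shows "a < b" "b < t"
    "sphere_linked f (\<xi> (Suc a)) (\<xi> b) \<Longrightarrow> sphere_linked f (\<xi> a) (\<xi> (Suc b))"
proof -
  obtain s s' s'' s''' where mem: "s \<in> {0..t}" "s' \<in> {0..t}" "s'' \<in> {0..t} - {s, s'}"
      "s''' \<in> {0..t} - {s, s'}"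
    and s: "\<bar>int s - int s'\<bar> = 1" "int s'' - int s''' = int s' - int s"
    and shadow: "shadows \<Omega> (\<xi> s'', \<xi> s''') (\<xi> s, \<xi> s')"
    and a: "a = Min {s, s', s'', s'''}" and b: "b = Max {s, s', s'', s'''} - 1"
    using assms unfolding double_step_def by (elim bexE conjE)
  have "s' = Suc s \<and> s'' = Suc s''' \<or> s = Suc s' \<and> s''' = Suc s''"
    using s by linarith
  \<comment> \<open>The shadowing step has the opposite orientation, so \<open>p\<close> is matched
    with \<open>Suc q\<close> and \<open>Suc p\<close> with \<open>q\<close>: the two pairs are
    nested.\<close>
  then obtain p q where pq: "s = p \<and> s' = Suc p \<and> s'' = Suc q \<and> s''' = q \<or>
      s = Suc p \<and> s' = p \<and> s'' = q \<and> s''' = Suc q"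
    by blast
  have iff: "sphere_linked f (\<xi> p) (\<xi> (Suc q)) \<longleftrightarrow> sphere_linked f (\<xi> (Suc p)) (\<xi> q)"
    using pq shadows_sphere_linked_iff[OF shadow] by metis
  have "Min {s, s', s'', s'''} = min (min s s') (min s'' s''')"
    "Max {s, s', s'', s'''} = max (max s s') (max s'' s''')"
    by (simp_all add: min.assoc max.assoc)
  then have "a = min p q" "b = max p q"
    using pq unfolding a b by (auto simp: min_def max_def)
  moreover have "Suc p \<le> t" "Suc q \<le> t" "p \<noteq> q" "p \<noteq> Suc q" "q \<noteq> Suc p"
    using pq mem by auto
  \<comment> \<open>Disjointness of the index pairs forces a gap, and the final \<open>- 1\<close>
    makes \<open>b\<close> the initial index of the later step.\<close>
  ultimately have order: "Suc p < q \<and> a = p \<and> b = q \<and> q < t \<or> Suc q < p \<and> a = q \<and> b = p \<and> p < t"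
    by linarith
  then show "a < b" "b < t" by auto
  show "sphere_linked f (\<xi> a) (\<xi> (Suc b))" if "sphere_linked f (\<xi> (Suc a)) (\<xi> b)"
    using order iff that sphere_linked_sym by blast
qed

end

text \<open>Each pair \<open>(a m, b m)\<close> closes up once the steps strictly between them are closed up; the
  noncrossing condition makes these intermediate steps a union of complete pairs.\<close>

lemma noncrossing_chain:
  fixes a b :: "nat \<Rightarrow> nat" and P :: "nat \<Rightarrow> nat \<Rightarrow> bool"
  assumes refl: "\<And>i. i \<le> t \<Longrightarrow> P i i"
    and trans: "\<And>i j k. j \<le> t \<Longrightarrow> P i j \<Longrightarrow> P j k \<Longrightarrow> P i k"
    and single: "\<And>i. i < t \<Longrightarrow> i \<notin> a ` M \<union> b ` M \<Longrightarrow> P i (Suc i)"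
    and ab: "\<And>m. m \<in> M \<Longrightarrow> a m < b m \<and> b m < t"
    and double: "\<And>m. m \<in> M \<Longrightarrow> P (Suc (a m)) (b m) \<Longrightarrow> P (a m) (Suc (b m))"
    and mono: "strict_mono_on M a"
    and noncrossing: "\<And>m n. m \<in> M \<Longrightarrow> n \<in> M \<Longrightarrow> m < n \<Longrightarrow> b m < a n \<or> b n < b m"
  shows "P 0 t"
proof -
  \<comment> \<open>The induction runs over intervals of steps that contain both members of a pair
    or neither.\<close>
  have "P i j" if "i \<le> j" "j \<le> t" "\<And>m. m \<in> M \<Longrightarrow> a m \<in> {i..<j} \<longleftrightarrow> b m \<in> {i..<j}" for i j
    using that
  proof (induction "j - i" arbitrary: i j rule: less_induct)
    case less
    note closed = less.prems(3)
    have order: "m < n \<longleftrightarrow> a m < a n" if "m \<in> M" "n \<in> M" for m n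
      using strict_mono_on_less[OF mono] that by blast
    have inj: "m = n" if "m \<in> M" "n \<in> M" "a m = a n" for m n
      using order[of m n] order[of n m] that by (simp add: nat_neq_iff)
    consider "i = j" | "i < j" "i \<notin> a ` M \<union> b ` M" | m where "i < j" "m \<in> M" "i = a m"
      | m where "i < j" "m \<in> M" "i = b m"
      using less.prems(1) by fastforce
    then show ?case
    proof cases
      case 1
      then show ?thesis using refl less.prems by simp
    next
      case 2
      have "P (Suc i) j"
      proof (rule less.hyps)
        fix m assume m: "m \<in> M"
        with 2 have "a m \<noteq> i" "b m \<noteq> i" by auto
        then show "a m \<in> {Suc i..<j} \<longleftrightarrow> b m \<in> {Suc i..<j}"
          using closed[OF m] by (auto simp: Suc_le_eq)
      qed (use 2 less.prems in auto)
      with single[OF _ 2(2)] trans[of "Suc i" i j] 2 less.prems show ?thesis by simp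
    next
      case (3 m)
      have b: "i < b m" "b m < j" using closed[OF 3(2)] ab[OF 3(2)] 3 by auto
      have "P (Suc i) (b m)"
      proof (rule less.hyps)
        fix n assume n: "n \<in> M"
        show "a n \<in> {Suc i..<b m} \<longleftrightarrow> b n \<in> {Suc i..<b m}"
        proof
          assume *: "a n \<in> {Suc i..<b m}"
          \<comment> \<open>The pair \<open>n\<close> opens after \<open>m\<close> and before
            \<open>b m\<close>, so noncrossing forces it to close before \<open>b m\<close>.\<close>
          then have "m < n" using order[OF 3(2) n] 3 by simp
          with noncrossing[OF 3(2) n] * ab[OF n] show "b n \<in> {Suc i..<b m}" by auto
        next
          assume *: "b n \<in> {Suc i..<b m}"
          then have "b n \<in> {i..<j}" using b by auto
          then have "i \<le> a n" using closed[OF n] by auto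
          moreover have "a n \<noteq> i" using inj[OF n 3(2)] * 3 by auto
          ultimately show "a n \<in> {Suc i..<b m}" using ab[OF n] * by auto
        qed
      qed (use 3 b less.prems in auto)
      then have "P i (Suc (b m))" using double[OF 3(2)] 3 by simp
      moreover have "P (Suc (b m)) j"
      proof (rule less.hyps)
        fix n assume n: "n \<in> M"
        show "a n \<in> {Suc (b m)..<j} \<longleftrightarrow> b n \<in> {Suc (b m)..<j}"
        proof
          assume *: "a n \<in> {Suc (b m)..<j}"
          then have "b n \<in> {i..<j}" using closed[OF n] b by auto
          with ab[OF n] * show "b n \<in> {Suc (b m)..<j}" by auto
        next
          assume *: "b n \<in> {Suc (b m)..<j}"
          then have an: "a n \<in> {i..<j}" using closed[OF n] b by auto
          moreover have "a n \<noteq> i" using inj[OF n 3(2)] * 3 by auto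
          \<comment> \<open>Here \<open>n\<close> closes after \<open>b m\<close>, so noncrossing
            leaves only \<open>b m < a n\<close>.\<close>
          ultimately have "m < n" using order[OF 3(2) n] 3 by simp
          with noncrossing[OF 3(2) n] * an show "a n \<in> {Suc (b m)..<j}" by auto
        qed
      qed (use 3 b less.prems in auto)
      ultimately show ?thesis using trans[of "Suc (b m)"] b less.prems by simp
    next
      case (4 m)
      \<comment> \<open>The first index cannot close a pair, since its opening index would lie below
        the interval.\<close>
      then show ?thesis using closed[OF 4(2)] ab[OF 4(2)] by auto
    qed
  qed
  from this[of 0 t] ab show ?thesis by force
qed

text \<open>Index \<open>i\<close> stands for the step from \<open>\<xi> i\<close> to
  \<open>\<xi> (Suc i)\<close>, which is why \<open>t\<close> is removed. The set \<open>R\<close>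
  of the remaining steps that are not simple carries the noncrossing pairing.\<close>

lemma hinged_sphere_linked:
  assumes "speared \<Omega>" "slice_regular_on \<Omega> f" "hinged \<Omega> x x'"
  shows "sphere_linked f x x'"
proof -
  obtain t \<xi> where chain: "is_chain \<Omega> t \<xi>" and ends: "\<xi> 0 = x" "\<xi> t = x'"
    using assms(3) by (auto simp: hinged_def)
  define R where "R = {0..t} - {t} - {s. simple_step \<Omega> t \<xi> s}"
  have sub: "\<xi> ` {0..t} \<subseteq> \<Omega>" and ex: "\<exists>l a b. card R = 2 * l \<and> R = a ` {1..l} \<union> b ` {1..l} \<and>
      (\<forall>m\<in>{1..l}. double_step \<Omega> t \<xi> (a m) (b m)) \<and> strict_mono_on {1..l} a \<and>
      (\<forall>m\<in>{1..l}. \<forall>n\<in>{1..l}. m < n \<longrightarrow> b m < a n \<or> b m > b n)"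
    using chain unfolding is_chain_def Let_def R_def by blast+
  from sub have \<xi>: "\<xi> i \<in> \<Omega>" if "i \<le> t" for i using that by auto
  from ex have "sphere_linked f (\<xi> 0) (\<xi> t)"
  proof (elim exE conjE)
    fix l :: nat and a b :: "nat \<Rightarrow> nat"
    assume R: "R = a ` {1..l} \<union> b ` {1..l}"
      and dbl: "\<forall>m\<in>{1..l}. double_step \<Omega> t \<xi> (a m) (b m)"
      and mono: "strict_mono_on {1..l} a"
      and nc: "\<forall>m\<in>{1..l}. \<forall>n\<in>{1..l}. m < n \<longrightarrow> b m < a n \<or> b m > b n"
    note double = double_step_sphere_linked[OF assms(1,2) bspec[OF dbl]]
    show "sphere_linked f (\<xi> 0) (\<xi> t)"
    proof (rule noncrossing_chain[where a = a and b = b and M = "{1..l}" and t = t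
          and P = "\<lambda>i j. sphere_linked f (\<xi> i) (\<xi> j)"])
      fix i assume "i < t" "i \<notin> a ` {1..l} \<union> b ` {1..l}"
      then have "simple_step \<Omega> t \<xi> i" using R by (auto simp: R_def)
      then show "sphere_linked f (\<xi> i) (\<xi> (Suc i))"
        by (rule simple_step_sphere_linked[OF assms(1,2)])
    next
      fix i assume "i \<le> t"
      then show "sphere_linked f (\<xi> i) (\<xi> i)"
        by (intro sphere_linked_refl[OF assms(1,2)] \<xi>)
    next
      fix i j k assume "j \<le> t" "sphere_linked f (\<xi> i) (\<xi> j)" "sphere_linked f (\<xi> j) (\<xi> k)"
      then show "sphere_linked f (\<xi> i) (\<xi> k)"
        using sphere_linked_trans[OF assms(1,2)] \<xi> by blast
    next
      fix m assume m: "m \<in> {1..l}"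
      show "a m < b m \<and> b m < t" using double(1,2)[OF m] by blast
      show "sphere_linked f (\<xi> (a m)) (\<xi> (Suc (b m)))"
        if "sphere_linked f (\<xi> (Suc (a m))) (\<xi> (b m))"
        using double(3)[OF m that] .
    next
      show "b m < a n \<or> b n < b m" if "m \<in> {1..l}" "n \<in> {1..l}" "m < n" for m n
        using nc that by blast
    qed (rule mono)
  qed
  then show ?thesis using ends by simp
qed

subsection \<open>Stem functions on hinged domains\<close>

text \<open>All points of \<open>\<Omega>\<close> on the sphere are mutually linked. Two distinct
  admissible units fix the coefficients, and every third unit agrees with them.\<close>

lemma hinged_domain_stem_exists:
  assumes hd: "hinged_domain \<Omega>" and reg: "slice_regular_on \<Omega> f" and z: "Im z \<ge> 0"
  obtains a b where "\<And>I. I \<in> \<S> \<Longrightarrow> slice_map I z \<in> \<Omega> \<Longrightarrow> f (slice_map I z) = a + I * b"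
proof -
  have spr: "speared \<Omega>" using hd by (simp add: hinged_domain_def speared_domain_def)
  have linked: "stem_linked f J K z"
    if "J \<in> \<S>" "K \<in> \<S>" "slice_map J z \<in> \<Omega>" "slice_map K z \<in> \<Omega>" for J K
  proof -
    have "hinged \<Omega> (slice_map J z) (slice_map K z)"
      using hd that slice_map_in_quat_sphere unfolding hinged_domain_def by blast
    from sphere_linkedD[OF spr reg hinged_sphere_linked[OF spr reg this]] that z show ?thesis by blast
  qed
  show thesis
  proof (cases "\<exists>J\<in>\<S>. \<exists>K\<in>\<S>. J \<noteq> K \<and> slice_map J z \<in> \<Omega> \<and> slice_map K z \<in> \<Omega>")
    case True
    then obtain J K where JK: "J \<in> \<S>" "K \<in> \<S>" "J \<noteq> K" "slice_map J z \<in> \<Omega>" "slice_map K z \<in> \<Omega>"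
      by blast
    show thesis
    proof (rule that[of "stem_a f J K z" "stem_b f J K z"])
      fix I assume I: "I \<in> \<S>" "slice_map I z \<in> \<Omega>"
      obtain a b where ab: "f (slice_map I z) = a + I * b" "f (slice_map J z) = a + J * b"
          "f (slice_map K z) = a + K * b"
        using stem_linked_eval[OF linked[of I J] linked[of J K]] I JK by blast
      then show "f (slice_map I z) = stem_a f J K z + I * stem_b f J K z"
        using stem_ab_unique[OF ab(2,3) JK(3)] by simp
    qed
  next
    \<comment> \<open>At most one unit is admissible, so the value there can be taken as
      \<open>a\<close>, with \<open>b\<close> equal to 0.\<close>
    case False
    show thesis
    proof (cases "\<exists>J\<in>\<S>. slice_map J z \<in> \<Omega>")
      case True
      then obtain J where "J \<in> \<S>" "slice_map J z \<in> \<Omega>" by blast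
      then show thesis
        using False by (intro that[of "f (slice_map J z)" 0]) auto
    qed (use that in blast)
  qed
qed

section \<open>Representation formula, spherical value and spherical derivative\<close>

lemma stem_recovery:
  fixes a b :: quat
  assumes "J \<in> \<S>" "K \<in> \<S>" "J \<noteq> K"
  shows "inverse (J - K) * (J * (a + J * b) - K * (a + K * b)) = a"
    "inverse (J - K) * ((a + J * b) - (a + K * b)) = b"
proof -
  have "J * (a + J * b) - K * (a + K * b) = (J - K) * a"
    using imag_units_mult_left_cancel assms by (simp add: algebra_simps)
  then show "inverse (J - K) * (J * (a + J * b) - K * (a + K * b)) = a"
    using assms(3) by (simp flip: mult.assoc)
  have "(a + J * b) - (a + K * b) = (J - K) * b" by (simp add: algebra_simps)
  then show "inverse (J - K) * ((a + J * b) - (a + K * b)) = b"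
    using assms(3) by (simp flip: mult.assoc)
qed

lemma hinged_domain_representation_formula:
  assumes "hinged_domain \<Omega>" "slice_regular_on \<Omega> f" "\<beta> \<ge> 0"
    and "I \<in> \<S>" "J \<in> \<S>" "K \<in> \<S>" "J \<noteq> K"
    and "slice_pt \<alpha> \<beta> I \<in> \<Omega>" "slice_pt \<alpha> \<beta> J \<in> \<Omega>" "slice_pt \<alpha> \<beta> K \<in> \<Omega>"
  shows "representation_formula f \<alpha> \<beta> I J K"
proof -
  obtain a b where ab: "\<And>I. I \<in> \<S> \<Longrightarrow> slice_pt \<alpha> \<beta> I \<in> \<Omega> \<Longrightarrow> f (slice_pt \<alpha> \<beta> I) = a + I * b"
    using hinged_domain_stem_exists[OF assms(1,2), of "Complex \<alpha> \<beta>"] assms(3)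
    by (auto simp: slice_pt_eq_slice_map)
  show ?thesis
    unfolding representation_formula_def mult.assoc
    by (simp only: ab[OF assms(4,8)] ab[OF assms(5,9)] ab[OF assms(6,10)] stem_recovery[OF assms(5-7)])
qed

lemma hinged_domain_representation_set:
  assumes "hinged_domain \<Omega>" "slice_regular_on \<Omega> f"
  shows "representation_set \<Omega> f J \<Omega>"
proof -
  have "core \<Omega> \<subseteq> \<Omega>" by (auto simp: core_def)
  moreover have "speared \<Omega>"
    using assms(1) by (simp add: hinged_domain_def speared_domain_def)
  ultimately show ?thesis
    using hinged_domain_representation_formula[OF assms]
    by (auto simp: representation_set_def half_slice_def)
qed

text \<open>The right-hand sides do not involve \<open>I\<close>, which gives constancy on the
  sphere. Taking \<open>\<Lambda>\<close> to be \<open>\<Omega>\<close> gives existence in the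
  definite descriptions.\<close>

lemma spherical_value_derivative_eq:
  assumes hd: "hinged_domain \<Omega>" and reg: "slice_regular_on \<Omega> f" and z: "Im z > 0"
    and JK: "J \<in> \<S>" "K \<in> \<S>" "J \<noteq> K" "slice_map J z \<in> \<Omega>" "slice_map K z \<in> \<Omega>"
    and I: "I \<in> \<S>" "slice_map I z \<in> \<Omega>"
  shows "spherical_value \<Omega> f (slice_map I z) = stem_a f J K z"
    "spherical_derivative \<Omega> f (slice_map I z) = of_real (inverse (Im z)) * stem_b f J K z"
proof -
  obtain a b where ab: "\<And>I. I \<in> \<S> \<Longrightarrow> slice_map I z \<in> \<Omega> \<Longrightarrow> f (slice_map I z) = a + I * b"
    using hinged_domain_stem_exists[OF hd reg, of z] z by auto
  have stem: "stem_a f J K z = a" "stem_b f J K z = b"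
    using stem_ab_unique[of f J z a b K] ab JK by auto
  have rep: "slice_map I z = slice_pt (Re z) (Im z) I" for I
    by (simp add: slice_map_def)
  have \<Lambda>: "representation_set \<Omega> f I \<Omega>"
    using hd reg by (rule hinged_domain_representation_set)
  have uniq: "\<alpha> = Re z \<and> \<beta> = Im z" if "slice_map I z = slice_pt \<alpha> \<beta> J\<^sub>0" "\<beta> \<ge> 0" "J\<^sub>0 \<in> \<S>" for \<alpha> \<beta> J\<^sub>0
    using slice_map_eqD(1)[of I z J\<^sub>0 "Complex \<alpha> \<beta>"] that z I(1) by (auto simp: slice_pt_eq_slice_map)
  show "spherical_value \<Omega> f (slice_map I z) = stem_a f J K z"
    unfolding spherical_value_def stem
  proof (rule the_equality)
    show "\<exists>\<alpha> \<beta>. \<exists>J\<^sub>0\<in>\<S>. \<exists>\<Lambda>. \<exists>J\<in>\<S>. \<exists>K\<in>\<S>.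
      \<beta> \<ge> 0 \<and> slice_map I z = slice_pt \<alpha> \<beta> J\<^sub>0 \<and> representation_set \<Omega> f J\<^sub>0 \<Lambda> \<and>
      J \<noteq> K \<and> slice_pt \<alpha> \<beta> J \<in> \<Lambda> \<and> slice_pt \<alpha> \<beta> K \<in> \<Lambda> \<and>
      a = inverse (J - K) * (J * f (slice_pt \<alpha> \<beta> J) - K * f (slice_pt \<alpha> \<beta> K))"
      using ab JK I \<Lambda> z stem_recovery(1)[OF JK(1-3)] unfolding rep
      by (intro exI[of _ "Re z"] exI[of _ "Im z"] bexI[of _ I] exI[of _ \<Omega>] bexI[of _ J] bexI[of _ K]) auto
  next
    fix v
    assume "\<exists>\<alpha> \<beta>. \<exists>J\<^sub>0\<in>\<S>. \<exists>\<Lambda>. \<exists>J\<in>\<S>. \<exists>K\<in>\<S>.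
      \<beta> \<ge> 0 \<and> slice_map I z = slice_pt \<alpha> \<beta> J\<^sub>0 \<and> representation_set \<Omega> f J\<^sub>0 \<Lambda> \<and>
      J \<noteq> K \<and> slice_pt \<alpha> \<beta> J \<in> \<Lambda> \<and> slice_pt \<alpha> \<beta> K \<in> \<Lambda> \<and>
      v = inverse (J - K) * (J * f (slice_pt \<alpha> \<beta> J) - K * f (slice_pt \<alpha> \<beta> K))"
    then obtain \<alpha> \<beta> J\<^sub>0 \<Lambda> J' K' where *: "J\<^sub>0 \<in> \<S>" "J' \<in> \<S>" "K' \<in> \<S>" "\<beta> \<ge> 0"
      "slice_map I z = slice_pt \<alpha> \<beta> J\<^sub>0" "representation_set \<Omega> f J\<^sub>0 \<Lambda>" "J' \<noteq> K'"
      "slice_pt \<alpha> \<beta> J' \<in> \<Lambda>" "slice_pt \<alpha> \<beta> K' \<in> \<Lambda>"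
      "v = inverse (J' - K') * (J' * f (slice_pt \<alpha> \<beta> J') - K' * f (slice_pt \<alpha> \<beta> K'))"
      by blast
    \<comment> \<open>Every admissible \<open>\<Lambda>\<close> lies in \<open>\<Omega>\<close>, so
      any choice of \<open>J'\<close> and \<open>K'\<close> in it recovers the same coefficient
      \<open>a\<close>.\<close>
    have "\<Lambda> \<subseteq> \<Omega>" using *(6) by (simp add: representation_set_def)
    with * uniq[OF *(5,4,1)] ab[unfolded rep] show "v = a"
      by (auto simp: subset_iff stem_recovery)
  qed
  show "spherical_derivative \<Omega> f (slice_map I z) = of_real (inverse (Im z)) * stem_b f J K z"
    unfolding spherical_derivative_def stem
  proof (rule the_equality)
    show "\<exists>\<alpha> \<beta>. \<exists>J\<^sub>0\<in>\<S>. \<exists>\<Lambda>. \<exists>J\<in>\<S>. \<exists>K\<in>\<S>.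
      \<beta> > 0 \<and> slice_map I z = slice_pt \<alpha> \<beta> J\<^sub>0 \<and> representation_set \<Omega> f J\<^sub>0 \<Lambda> \<and>
      J \<noteq> K \<and> slice_pt \<alpha> \<beta> J \<in> \<Lambda> \<and> slice_pt \<alpha> \<beta> K \<in> \<Lambda> \<and>
      of_real (inverse (Im z)) * b =
        of_real (inverse \<beta>) * inverse (J - K) * (f (slice_pt \<alpha> \<beta> J) - f (slice_pt \<alpha> \<beta> K))"
      using ab JK I \<Lambda> z stem_recovery(2)[OF JK(1-3)] unfolding rep
      by (intro exI[of _ "Re z"] exI[of _ "Im z"] bexI[of _ I] exI[of _ \<Omega>] bexI[of _ J] bexI[of _ K])
        (auto simp: mult.assoc)
  next
    fix v
    assume "\<exists>\<alpha> \<beta>. \<exists>J\<^sub>0\<in>\<S>. \<exists>\<Lambda>. \<exists>J\<in>\<S>. \<exists>K\<in>\<S>.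
      \<beta> > 0 \<and> slice_map I z = slice_pt \<alpha> \<beta> J\<^sub>0 \<and> representation_set \<Omega> f J\<^sub>0 \<Lambda> \<and>
      J \<noteq> K \<and> slice_pt \<alpha> \<beta> J \<in> \<Lambda> \<and> slice_pt \<alpha> \<beta> K \<in> \<Lambda> \<and>
      v = of_real (inverse \<beta>) * inverse (J - K) * (f (slice_pt \<alpha> \<beta> J) - f (slice_pt \<alpha> \<beta> K))"
    then obtain \<alpha> \<beta> J\<^sub>0 \<Lambda> J' K' where *: "J\<^sub>0 \<in> \<S>" "J' \<in> \<S>" "K' \<in> \<S>" "\<beta> > 0"
      "slice_map I z = slice_pt \<alpha> \<beta> J\<^sub>0" "representation_set \<Omega> f J\<^sub>0 \<Lambda>" "J' \<noteq> K'"
      "slice_pt \<alpha> \<beta> J' \<in> \<Lambda>" "slice_pt \<alpha> \<beta> K' \<in> \<Lambda>"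
      "v = of_real (inverse \<beta>) * inverse (J' - K') * (f (slice_pt \<alpha> \<beta> J') - f (slice_pt \<alpha> \<beta> K'))"
      by blast
    have "\<Lambda> \<subseteq> \<Omega>" using *(6) by (simp add: representation_set_def)
    with * uniq[OF *(5) _ *(1)] ab[unfolded rep] stem_recovery(2)[OF *(2,3,7), of a b]
    show "v = of_real (inverse (Im z)) * b"
      by (auto simp: subset_iff mult.assoc)
  qed
qed

lemma hinged_domain_spherical_constant:
  assumes hd: "hinged_domain \<Omega>" and reg: "slice_regular_on \<Omega> f"
  shows "spherical_value \<Omega> f constant_on (quat_sphere x \<inter> \<Omega>)"
    "spherical_derivative \<Omega> f constant_on (quat_sphere x \<inter> \<Omega>)"
proof -
  obtain I z where I: "I \<in> \<S>" "Im z \<ge> 0" "x = slice_map I z"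
    by (rule quat_slice_cases)
  have "spherical_value \<Omega> f y = spherical_value \<Omega> f y' \<and>
      spherical_derivative \<Omega> f y = spherical_derivative \<Omega> f y'"
    if y: "y \<in> quat_sphere x \<inter> \<Omega>" "y' \<in> quat_sphere x \<inter> \<Omega>" for y y'
  proof (cases "y = y'")
    case False
    obtain J where J: "J \<in> \<S>" "y = slice_map J z" using quat_sphere_slice_map[of y I z] y I by blast
    obtain K where K: "K \<in> \<S>" "y' = slice_map K z" using quat_sphere_slice_map[of y' I z] y I by blast
    \<comment> \<open>Over a real \<open>z\<close> all units give one point, so two distinct points
      force \<open>Im z > 0\<close>; they also supply the two distinct units.\<close>
    have "Im z \<noteq> 0" using False J K slice_map_real by metis
    then have "Im z > 0" using I(2) by simp
    moreover have "J \<noteq> K" using False J K by auto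
    ultimately show ?thesis
      using spherical_value_derivative_eq[OF hd reg _ J(1) K(1)] y J K by auto
  qed simp
  then show "spherical_value \<Omega> f constant_on (quat_sphere x \<inter> \<Omega>)"
    "spherical_derivative \<Omega> f constant_on (quat_sphere x \<inter> \<Omega>)"
    unfolding constant_on_def by metis+
qed

theorem corollary5p13:
  fixes \<Omega> :: "quat set" and f :: "quat \<Rightarrow> quat"
  assumes "hinged_domain \<Omega>"
    and "slice_regular_on \<Omega> f"
  shows "(\<forall>\<alpha> \<beta>. \<forall>I\<in>\<S>. \<forall>J\<in>\<S>. \<forall>K\<in>\<S>. \<beta> \<ge> 0 \<longrightarrow> J \<noteq> K \<longrightarrow>
            slice_pt \<alpha> \<beta> I \<in> \<Omega> \<longrightarrow> slice_pt \<alpha> \<beta> J \<in> \<Omega> \<longrightarrow> slice_pt \<alpha> \<beta> K \<in> \<Omega> \<longrightarrow>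
            f (slice_pt \<alpha> \<beta> I) =
              inverse (J - K) * (J * f (slice_pt \<alpha> \<beta> J) - K * f (slice_pt \<alpha> \<beta> K)) +
              I * inverse (J - K) * (f (slice_pt \<alpha> \<beta> J) - f (slice_pt \<alpha> \<beta> K)))
       \<and> (\<forall>x\<in>\<Omega>. spherical_value \<Omega> f constant_on (quat_sphere x \<inter> \<Omega>))
       \<and> (\<forall>x\<in>\<Omega> - \<real>. spherical_derivative \<Omega> f constant_on (quat_sphere x \<inter> \<Omega>))"
  using hinged_domain_representation_formula[OF assms] hinged_domain_spherical_constant[OF assms]
  unfolding representation_formula_def by blast

end
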